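(* Let $1<p<\infty$, let $(X,d,\mu)$ be a doubling metric measure space and let $\theta>0$. Suppose that the dimension of the vector space $B^\theta_{p,p}(X)$ is finite. Then either $\mu(X)=\infty$ and $B^\theta_{p,p}(X)=\{0\}$ (in which case $\theta\ge\theta_p(X)$), or there exist measurable sets $E_1,\dots,E_k\subset X$, with $k$ the dimension of $B^\theta_{p,p}(X)$, such that the following hold: (1) $0<\mu(E_i)<\infty$ for $i=1,\dots,k$. (2) If $\mu(X)<\infty$, then $\mu\left(X\setminus\bigcup_{i=1}^kE_i\right)=0$. (3) $\chi_{E_i}\in B^\theta_{p,p}(X)$ for $i=1,\dots,k$, and $\{\chi_{E_i}: i=1,\dots,k\}$ forms a basis for $B^\theta_{p,p}(X)$. (4) $B^\theta_{p,p}(X)=\bigoplus_{i=1}^kB^\theta_{p,p}(E_i):=\{f\in L^p(X): f|_{E_i}\in B^\theta_{p,p}(E_i),\ i=1,\dots,k\}$ as sets. Moreover, the dimension of $B^\theta_{p,p}(E_i)$ is $1$ for all $i=1,\dots,k$. (5) $\|\chi_{E_i}\|_{KS^\theta_p(X)}=0$ for $i=1,\dots,k$. (6) If $u\in KS^\theta_p(X)\cap L^\infty(X)$, then for $j=1,\dots,k$ we have $$\|u\,\chi_{E_j}\|_{KS^\theta_p(X)}^p=\limsup_{r\to0^+}\int_{E_j}\int_{B(x,r)\cap E_j}\frac{|u(y)-u(x)|^p}{r^{\theta p}\,\mu(B(x,r))}\,d\mu(y)\,d\mu(x).$$ (7) $\theta\le\theta_p(X)$ if $k>1$, or if $\mu(X)=\infty$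 with $k=1$; and $\theta\ge\theta_p(X)$ if $\mu(X)<\infty$ and $k=1$.
   Context: Throughout, $(X,d)$ is a separable metric space with infinitely many points and $\mu$ is a Borel measure on $X$ with $0<\mu(B(x,r))<\infty$ for all $x\in X$, $r>0$, where $B(x,r)=\{y\in X: d(x,y)<r\}$. The space $(X,d,\mu)$ is a doubling metric measure space if there is a constant $C_{\mathrm D}$ such that $0<\mu(B(x,2r))\le C_{\mathrm D}\,\mu(B(x,r))<\infty$ for all $x\in X$, $r>0$. Functions are identified when they agree $\mu$-a.e.; $\chi_E$ is the characteristic function of $E$. For $\theta>0$, $B^\theta_{p,p}(X)$ is the vector space of $u\in L^p(X)$ with $$\|u\|_{B^\theta_{p,p}(X)}^p:=\int_X\int_X\frac{|u(y)-u(x)|^p}{d(x,y)^{\theta p}\,\mu(B(x,d(x,y)))}\,d\mu(y)\,d\mu(x)<\infty$$ (the integrand is taken to be $0$ when $x=y$), and $KS^\theta_p(X)$ is the space of $u\in L^p(X)$ with $$\|u\|_{KS^\theta_p(X)}^p:=\limsup_{t\to0^+}\int_X\frac{1}{\mu(B(x,t))}\int_{B(x,t)}\frac{|u(y)-u(x)|^p}{t^{\theta p}}\,d\mu(y)\,d\mu(x)<\infty.$$ For a measurable set $E\subset X$ with $\mu(E)>0$, $B^\theta_{p,p}(E)$ is defined by the same formula with $(X,d,\mu)$ replaced by $(E,d|_{E\times E},\mu|_E)$. The critical exponent is $\theta_p(X):=\sup\{\theta>0: B^\theta_{p,p}(X)\text{ contains non-constant functions}\}$.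
   Formalization: In (4), when μ(X)=∞ the displayed set is replaced by its functions that also vanish a.e. outside the union of the E_i; as displayed it fails, e.g. X=[0,1]∪[2,∞), θ≥1, where χ_[2,3] is in it but not in B(X). For μ(X)<∞ the displayed equality is proved as stated. *)

theory Defs
  imports "HOL-Analysis.Analysis"
begin

text \<open>
  A metric measure space is a measure \<open>M\<close> whose underlying set \<open>space M\<close> is a subset of a metric
  space type and carries the induced metric. The whole space \<open>X\<close> is the case \<open>space M = UNIV\<close>; a
  measurable subset \<open>E\<close> with the restricted metric and measure is \<open>restrict_space M E\<close>. Balls of
  the metric measure space are therefore \<open>ball x r \<inter> space M\<close>.

  The function spaces below are sets of measurable representatives; identification almost
  everywhere is built into the notions of constant function, basis and dimension. On
  \<open>restrict_space M E\<close> only the values of a function on \<open>E\<close> matter, so a function on \<open>X\<close> stands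
  for its restriction to \<open>E\<close>.
\<close>

definition doubling :: "'a::metric_space measure \<Rightarrow> bool" where
  "doubling M \<longleftrightarrow> (\<exists>C::real. \<forall>x\<in>space M. \<forall>r>0.
     0 < emeasure M (ball x (2 * r) \<inter> space M) \<and>
     emeasure M (ball x (2 * r) \<inter> space M) \<le> ennreal C * emeasure M (ball x r \<inter> space M) \<and>
     ennreal C * emeasure M (ball x r \<inter> space M) < \<infinity>)"

definition Lp_fun :: "'a measure \<Rightarrow> real \<Rightarrow> ('a \<Rightarrow> real) set" where
  "Lp_fun M p = {u \<in> borel_measurable M. (\<integral>\<^sup>+x. ennreal (\<bar>u x\<bar> powr p) \<partial>M) < \<infinity>}"

definition Linfty_fun :: "'a measure \<Rightarrow> ('a \<Rightarrow> real) set" where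
  "Linfty_fun M = {u \<in> borel_measurable M. \<exists>C. AE x in M. \<bar>u x\<bar> \<le> C}"

text \<open>The \<open>p\<close>-th power of the Besov seminorm.\<close>

definition besov_energy :: "'a::metric_space measure \<Rightarrow> real \<Rightarrow> real \<Rightarrow> ('a \<Rightarrow> real) \<Rightarrow> ennreal" where
  "besov_energy M p \<theta> u =
     (\<integral>\<^sup>+x. (\<integral>\<^sup>+y. (if x = y then 0 else
        ennreal (\<bar>u y - u x\<bar> powr p) /
          (ennreal (dist x y powr (\<theta> * p)) * emeasure M (ball x (dist x y) \<inter> space M))) \<partial>M) \<partial>M)"

definition besov :: "'a::metric_space measure \<Rightarrow> real \<Rightarrow> real \<Rightarrow> ('a \<Rightarrow> real) set" where
  "besov M p \<theta> = {u \<in> Lp_fun M p. besov_energy M p \<theta> u < \<infinity>}"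

text \<open>The \<open>p\<close>-th power of the Korevaar-Schoen seminorm.\<close>

definition ks_energy :: "'a::metric_space measure \<Rightarrow> real \<Rightarrow> real \<Rightarrow> ('a \<Rightarrow> real) \<Rightarrow> ennreal" where
  "ks_energy M p \<theta> u =
     Limsup (at_right 0) (\<lambda>t::real.
       \<integral>\<^sup>+x. 1 / emeasure M (ball x t \<inter> space M) *
         (\<integral>\<^sup>+y\<in>ball x t \<inter> space M. ennreal (\<bar>u y - u x\<bar> powr p / t powr (\<theta> * p)) \<partial>M) \<partial>M)"

definition ks_space :: "'a::metric_space measure \<Rightarrow> real \<Rightarrow> real \<Rightarrow> ('a \<Rightarrow> real) set" where
  "ks_space M p \<theta> = {u \<in> Lp_fun M p. ks_energy M p \<theta> u < \<infinity>}"

definition ae_constant :: "'a measure \<Rightarrow> ('a \<Rightarrow> real) \<Rightarrow> bool" where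
  "ae_constant M u \<longleftrightarrow> (\<exists>c. AE x in M. u x = c)"

text \<open>The supremum is taken in \<open>[0, \<infinity>]\<close>.\<close>

definition critical_exponent :: "'a::metric_space measure \<Rightarrow> real \<Rightarrow> ennreal" where
  "critical_exponent M p =
     Sup {ennreal \<theta> | \<theta>. 0 < \<theta> \<and> (\<exists>u\<in>besov M p \<theta>. \<not> ae_constant M u)}"

text \<open>
  \<open>ae_basis M V k b\<close>: the almost-everywhere classes of \<open>b 0, \<dots>, b (k - 1)\<close> form a basis of the
  vector space of almost-everywhere classes of elements of \<open>V\<close>.
\<close>

definition ae_basis ::
    "'a measure \<Rightarrow> ('a \<Rightarrow> real) set \<Rightarrow> nat \<Rightarrow> (nat \<Rightarrow> 'a \<Rightarrow> real) \<Rightarrow> bool" where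
  "ae_basis M V k b \<longleftrightarrow>
     (\<forall>i<k. b i \<in> V) \<and>
     (\<forall>c. (AE x in M. (\<Sum>i<k. c i * b i x) = 0) \<longrightarrow> (\<forall>i<k. c i = 0)) \<and>
     (\<forall>f\<in>V. \<exists>c. AE x in M. f x = (\<Sum>i<k. c i * b i x))"

definition has_ae_dim :: "'a measure \<Rightarrow> ('a \<Rightarrow> real) set \<Rightarrow> nat \<Rightarrow> bool" where
  "has_ae_dim M V k \<longleftrightarrow> (\<exists>b. ae_basis M V k b)"

text \<open>
  The functions in \<open>L\<^sup>p(X)\<close> whose restrictions to all \<open>E i\<close> are Besov. This imposes no regularity
  outside the union of the \<open>E i\<close>, so it is the direct sum of the spaces over the \<open>E i\<close> only if that
  union has full measure. In general the summands are extended by zero, i.e. the direct sum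
  consists of those functions that moreover vanish almost everywhere outside the union.
\<close>

definition besov_pieces ::
    "'a::metric_space measure \<Rightarrow> real \<Rightarrow> real \<Rightarrow> nat \<Rightarrow> (nat \<Rightarrow> 'a set) \<Rightarrow> ('a \<Rightarrow> real) set" where
  "besov_pieces M p \<theta> k E =
     {f \<in> Lp_fun M p. \<forall>i<k. f \<in> besov (restrict_space M (E i)) p \<theta>}"

definition besov_direct_sum ::
    "'a::metric_space measure \<Rightarrow> real \<Rightarrow> real \<Rightarrow> nat \<Rightarrow> (nat \<Rightarrow> 'a set) \<Rightarrow> ('a \<Rightarrow> real) set" where
  "besov_direct_sum M p \<theta> k E =
     {f \<in> besov_pieces M p \<theta> k E. AE x in M. x \<notin> (\<Union>i<k. E i) \<longrightarrow> f x = 0}"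

end

theory Submission
  imports Defs
begin

text \<open>
  \<open>V = B\<^sup>\<theta>\<^sub>p\<^sub>,\<^sub>p(X)\<close> is stable under composition with Lipschitz functions vanishing at 0. If \<open>V\<close> is
  finite dimensional it is closed under almost everywhere limits, so truncations of \<open>u \<in> V\<close> yield
  indicators of superlevel sets \<open>{u > s}\<close>, \<open>s > 0\<close>, in \<open>V\<close>. A maximal disjoint family of non-null
  sets with indicator in \<open>V\<close> therefore consists of atoms: every \<open>u \<in> V\<close> is constant on each of them
  and vanishes outside their union. The Korevaar-Schoen integrals of a Besov function are dominated
  by its energy over \<open>{d(x,y) < t}\<close>, which tends to 0; this makes the cut-off by an atom invisible to
  the Korevaar-Schoen energy. Finally \<open>B\<^sup>\<theta>\<^sub>p\<^sub>,\<^sub>p\<close> decreases in \<open>\<theta>\<close> by doubling.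
\<close>

text \<open>No norm on \<open>V\<close> enters the search for atoms. The truncations at level
  \<open>s\<close> have Lipschitz constant \<open>n\<close>, so their energies need not stay bounded
  and no compactness or completeness of the space is at hand; finite dimension has to supply the
  limit from almost everywhere convergence alone. Nonzero constants lie in \<open>V\<close> only if
  the measure is finite, hence only maps fixing 0 may be applied to \<open>u\<close>: negative
  levels are reached through \<open>- u\<close>, and level 0 is bypassed by an infimum. Disjoint
  non-null indicators are independent, so the dimension caps the length of a disjoint family and a
  longest one exists. The obstacle in the direct sum is that a function of finite energy on an atom,
  extended by zero, may have infinite energy between the atom and its complement. Bounded functions
  do not have this defect. Truncations therefore lie in \<open>V\<close> and are constant on the
  atom, which forces the function itself to be constant there.\<close>

section \<open>Linear algebra modulo null sets\<close>

lemma underdetermined_system: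
  fixes a :: "nat \<Rightarrow> nat \<Rightarrow> real"
  assumes "k < m"
  shows "\<exists>c. (\<exists>j<m. c j \<noteq> 0) \<and> (\<forall>i<k. (\<Sum>j<m. c j * a j i) = 0)"
  using assms
proof (induction k arbitrary: m a)
  case 0
  then show ?case by (intro exI[of _ "\<lambda>_. 1"]) auto
next
  case (Suc k)
  obtain n where m: "m = Suc n" and n: "k < n" using Suc.prems by (cases m) auto
  show ?case
  proof (cases "\<forall>j<m. a j k = 0")
    case True
    obtain c where "\<exists>j<m. c j \<noteq> 0" "\<forall>i<k. (\<Sum>j<m. c j * a j i) = 0"
      using Suc.IH[of m a] n m by auto
    then show ?thesis using True by (intro exI[of _ c]) (auto simp: less_Suc_eq)
  next
    case False
    then obtain q where q: "q < m" "a q k \<noteq> 0" by auto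
    \<comment> \<open>The transposition moves the pivot to the last unknown, so that the unknowns
      left after elimination are again indexed by an initial segment, as the induction
      requires.\<close>
    define s where "s = Transposition.transpose q n"
    have bij: "bij_betw s {..<m} {..<m}"
      unfolding s_def by (rule bij_betw_byWitness[where f' = "Transposition.transpose q n"])
        (use q m in \<open>auto simp: Transposition.transpose_def\<close>)
    define b where "b j i = a (s j) i" for j i
    have bn: "b n k \<noteq> 0" using q by (simp add: b_def s_def)
    obtain c where c: "\<exists>j<n. c j \<noteq> 0"
        "\<forall>i<k. (\<Sum>j<n. c j * (b j i - b j k / b n k * b n i)) = 0"
      using Suc.IH[OF n, of "\<lambda>j i. b j i - b j k / b n k * b n i"] by auto
    define d where "d j = (if j < n then c j else - (\<Sum>j<n. c j * b j k) / b n k)" for j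
    have expand: "(\<Sum>j<m. d j * b j i) = (\<Sum>j<n. c j * (b j i - b j k / b n k * b n i))" for i
      by (simp add: m d_def sum_subtractf sum_distrib_left sum_divide_distrib algebra_simps)
    have "(\<Sum>j<m. d j * b j i) = 0" if "i < Suc k" for i
      unfolding expand using that c bn by (cases "i = k") auto
    moreover have "(\<Sum>j<m. d (s j) * a j i) = (\<Sum>j<m. d j * b j i)" for i
    proof -
      have "(\<Sum>j<m. d j * b j i) = (\<Sum>j<m. (\<lambda>j. d (s j) * a j i) (s j))"
        by (simp add: b_def s_def)
      then show ?thesis using sum.reindex_bij_betw[OF bij, of "\<lambda>j. d (s j) * a j i"] by simp
    qed
    moreover have "\<exists>j<m. d (s j) \<noteq> 0"
    proof -
      obtain j where "j < n" "c j \<noteq> 0" using c by auto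
      moreover have "s j < m" "s (s j) = j"
        using \<open>j < n\<close> q m by (auto simp: s_def Transposition.transpose_def)
      ultimately show ?thesis by (intro exI[of _ "s j"]) (auto simp: d_def)
    qed
    ultimately show ?thesis by (intro exI[of _ "\<lambda>j. d (s j)"]) auto
  qed
qed

text \<open>The Steinitz bound for almost everywhere classes: a nontrivial vector killed by the
  matrix of expansions is a forbidden relation, and only finitely many null sets are discarded. It
  bounds disjoint families and later identifies their maximal length with the dimension.\<close>

lemma ae_independent_card_le:
  fixes b w :: "nat \<Rightarrow> 'a \<Rightarrow> real"
  assumes span: "\<And>j. j < m \<Longrightarrow> \<exists>c. AE x in M. w j x = (\<Sum>i<k. c i * b i x)"
    and indep: "\<And>c. (AE x in M. (\<Sum>j<m. c j * w j x) = 0) \<Longrightarrow> \<forall>j<m. c j = 0"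
  shows "m \<le> k"
proof (rule ccontr)
  assume "\<not> m \<le> k"
  obtain a where a: "\<And>j. j < m \<Longrightarrow> AE x in M. w j x = (\<Sum>i<k. a j i * b i x)"
    using span by metis
  obtain c where c: "\<exists>j<m. c j \<noteq> 0" "\<forall>i<k. (\<Sum>j<m. c j * a j i) = 0"
    using underdetermined_system[of k m a] \<open>\<not> m \<le> k\<close> by auto
  have "AE x in M. \<forall>j\<in>{..<m}. w j x = (\<Sum>i<k. a j i * b i x)"
    by (subst AE_finite_all) (use a in auto)
  then have "AE x in M. (\<Sum>j<m. c j * w j x) = 0"
  proof eventually_elim
    case (elim x)
    then have "(\<Sum>j<m. c j * w j x) = (\<Sum>j<m. \<Sum>i<k. c j * a j i * b i x)"
      by (simp add: sum_distrib_left mult.assoc)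
    also have "\<dots> = (\<Sum>i<k. (\<Sum>j<m. c j * a j i) * b i x)"
      by (subst sum.swap) (simp add: sum_distrib_right)
    finally show ?case using c(2) by simp
  qed
  then show False using indep c(1) by blast
qed

text \<open>The coefficients may diverge even though the sums converge, because the
  \<open>b i\<close> may be dependent. Induction removes the last function: a divergent coefficient
  exposes \<open>b k\<close> as redundant, and a coefficient bounded along a subsequence may be
  assumed to converge.\<close>

lemma ae_span_closed:
  fixes b :: "nat \<Rightarrow> 'a \<Rightarrow> real" and c :: "nat \<Rightarrow> nat \<Rightarrow> real"
  assumes "AE x in M. (\<lambda>n. \<Sum>i<k. c n i * b i x) \<longlonglongrightarrow> g x"
  shows "\<exists>d. AE x in M. g x = (\<Sum>i<k. d i * b i x)"
  using assms
proof (induction k arbitrary: c g)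
  case 0
  then show ?case by (auto elim!: eventually_mono dest: LIMSEQ_unique[OF tendsto_const])
next
  case (Suc k)
  show ?case
  proof (cases "filterlim (\<lambda>n. c n k) at_infinity sequentially")
    case True
    \<comment> \<open>Division by the diverging coefficient sends the convergent sums to 0, which
      exhibits \<open>- b k\<close> as a limit of combinations of the earlier functions; the
      induction hypothesis then puts it in their span, and it is substituted away.\<close>
    have "AE x in M. (\<lambda>n. \<Sum>i<k. c n i / c n k * b i x) \<longlonglongrightarrow> - b k x"
      using Suc.prems
    proof eventually_elim
      case (elim x)
      have "(\<lambda>n. (\<Sum>i<Suc k. c n i * b i x) / c n k - b k x) \<longlonglongrightarrow> 0 - b k x"
        by (intro tendsto_diff tendsto_divide_0[OF elim True] tendsto_const)
      moreover have "\<forall>\<^sub>F n in sequentially. (\<Sum>i<Suc k. c n i * b i x) / c n k - b k x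
          = (\<Sum>i<k. c n i / c n k * b i x)"
        using filterlim_at_infinity_imp_eventually_ne[OF True, of 0]
        by eventually_elim (simp add: add_divide_distrib sum_divide_distrib)
      ultimately have "(\<lambda>n. \<Sum>i<k. c n i / c n k * b i x) \<longlonglongrightarrow> 0 - b k x"
        by (rule Lim_transform_eventually)
      then show ?case by simp
    qed
    from Suc.IH[OF this] obtain e where e: "AE x in M. - b k x = (\<Sum>i<k. e i * b i x)" by blast
    have "AE x in M. (\<lambda>n. \<Sum>i<k. (c n i - c n k * e i) * b i x) \<longlonglongrightarrow> g x"
      using Suc.prems e
    proof eventually_elim
      case (elim x)
      have "(\<Sum>i<Suc k. c n i * b i x) = (\<Sum>i<k. (c n i - c n k * e i) * b i x)" for n
      proof -
        have "(\<Sum>i<k. (c n i - c n k * e i) * b i x)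
            = (\<Sum>i<k. c n i * b i x) - c n k * (\<Sum>i<k. e i * b i x)"
          by (simp add: left_diff_distrib sum_subtractf sum_distrib_left mult.assoc)
        also have "\<dots> = (\<Sum>i<Suc k. c n i * b i x)" by (subst elim(2)[symmetric]) simp
        finally show ?thesis ..
      qed
      then show ?case using elim(1) by simp
    qed
    from Suc.IH[OF this] obtain d where "AE x in M. g x = (\<Sum>i<k. d i * b i x)" by blast
    then show ?thesis by (intro exI[of _ "d(k := 0)"]) simp
  next
    case False
    then obtain B where "\<not> (\<forall>\<^sub>F n in sequentially. B \<le> norm (c n k))"
      unfolding filterlim_at_infinity_conv_norm_at_top filterlim_at_top by blast
    \<comment> \<open>Failing to tend to infinity leaves a bound \<open>B\<close> respected by
      infinitely many indices; Bolzano-Weierstrass applies along them.\<close>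
    then have "infinite {n. \<not> B \<le> norm (c n k)}"
      by (simp add: eventually_cofinite flip: cofinite_eq_sequentially)
    then obtain r :: "nat \<Rightarrow> nat" where r: "strict_mono r" "\<And>n. norm (c (r n) k) \<le> B"
      using infinite_enumerate[of "{n. \<not> B \<le> norm (c n k)}"] by (auto simp: not_le intro: less_imp_le)
    then have "bounded (range (\<lambda>n. c (r n) k))" by (auto simp: bounded_iff)
    then obtain l s where s: "strict_mono s" "((\<lambda>n. c (r n) k) \<circ> s) \<longlonglongrightarrow> l"
      using bounded_imp_convergent_subsequence by blast
    have rs: "strict_mono (r \<circ> s)" using r s by (simp add: strict_mono_o)
    have "AE x in M. (\<lambda>n. \<Sum>i<k. c ((r \<circ> s) n) i * b i x) \<longlonglongrightarrow> g x - l * b k x"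
      using Suc.prems
    proof eventually_elim
      case (elim x)
      have "(\<lambda>n. (\<Sum>i<Suc k. c ((r \<circ> s) n) i * b i x) - c ((r \<circ> s) n) k * b k x)
          \<longlonglongrightarrow> g x - l * b k x"
        using LIMSEQ_subseq_LIMSEQ[OF elim rs] s(2)
        by (intro tendsto_diff tendsto_mult tendsto_const) (simp_all add: o_def)
      then show ?case by simp
    qed
    from Suc.IH[OF this] obtain d where "AE x in M. g x - l * b k x = (\<Sum>i<k. d i * b i x)"
      by blast
    then show ?thesis by (intro exI[of _ "d(k := l)"]) auto
  qed
qed

text \<open>The constant is the essential supremum of \<open>f\<close> on \<open>E\<close>, which
  the zero-one alternative makes the essential infimum as well. It is finite because
  \<open>f\<close> is real valued and \<open>E\<close> is not null. Level 0 is excluded since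
  superlevel sets of \<open>f\<close> and \<open>- f\<close> are available at positive levels
  only.\<close>

lemma ae_constant_on_if_zero_one:
  fixes f :: "'a \<Rightarrow> real"
  assumes pos: "\<not> (AE x in M. x \<notin> E)"
    and zo: "\<And>s. s \<noteq> 0 \<Longrightarrow> (AE x in M. x \<in> E \<longrightarrow> f x \<le> s) \<or> (AE x in M. x \<in> E \<longrightarrow> s \<le> f x)"
  shows "\<exists>c. AE x in M. x \<in> E \<longrightarrow> f x = c"
proof -
  define S where "S = {s. AE x in M. x \<in> E \<longrightarrow> f x \<le> s}"
  have up: "t \<in> S" if "s \<in> S" "s \<le> t" for s t
    using that unfolding S_def by (auto elim: eventually_mono)
  have "S \<noteq> {}"
  proof
    assume "S = {}"
    then have "AE x in M. x \<in> E \<longrightarrow> real (Suc n) \<le> f x" for n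
      using zo[of "real (Suc n)"] by (auto simp: S_def)
    then have "AE x in M. \<forall>n. x \<in> E \<longrightarrow> real (Suc n) \<le> f x"
      unfolding AE_all_countable by blast
    then have "AE x in M. x \<notin> E"
    proof eventually_elim
      case (elim x)
      then show ?case using reals_Archimedean2[of "f x"]
        by (metis less_asym' less_le_trans lessI of_nat_less_iff)
    qed
    with pos show False by simp
  qed
  have "bdd_below S"
  proof (rule ccontr)
    assume nb: "\<not> bdd_below S"
    have "- real n \<in> S" for n
      using nb up unfolding bdd_below_def by (meson linear)
    then have "AE x in M. \<forall>n. x \<in> E \<longrightarrow> f x \<le> - real n"
      unfolding AE_all_countable S_def by blast
    then have "AE x in M. x \<notin> E"
    proof eventually_elim
      case (elim x)
      then show ?case using reals_Archimedean2[of "- f x"] by (meson minus_less_iff not_le)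
    qed
    with pos show False by simp
  qed
  define c where "c = Inf S"
  have "AE x in M. \<forall>n. x \<in> E \<longrightarrow> f x \<le> c + 1 / real (Suc n)"
  proof -
    have "c + 1 / real (Suc n) \<in> S" for n
    proof -
      have "Inf S < c + 1 / real (Suc n)" by (simp add: c_def)
      then show ?thesis using cInf_lessD[OF \<open>S \<noteq> {}\<close>] up by (meson less_imp_le)
    qed
    then show ?thesis unfolding AE_all_countable S_def by blast
  qed
  moreover have "AE x in M. \<forall>n. x \<in> E \<longrightarrow> c - 1 / real (Suc n) \<le> f x"
  proof -
    have "AE x in M. x \<in> E \<longrightarrow> c - 1 / real (Suc n) \<le> f x" for n
    proof -
      \<comment> \<open>A level strictly below \<open>c\<close> is wanted, within
        \<open>1 / real (Suc n)\<close> of it and nonzero. The left endpoint serves unless it is 0,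
        in which case \<open>c\<close> is positive and \<open>c / 2\<close> serves.\<close>
      obtain s where s: "c - 1 / real (Suc n) \<le> s" "s < c" "s \<noteq> 0"
      proof (cases "c - 1 / real (Suc n) = 0")
        case True
        then have "c = 1 / real (Suc n)" by simp
        moreover have "0 < 1 / real (Suc n)" by simp
        ultimately have "0 < c" by argo
        then show ?thesis using that[of "c / 2"] True by (simp add: divide_right_mono)
      next
        case False
        then show ?thesis using that[of "c - 1 / real (Suc n)"] by simp
      qed
      have "s \<notin> S" using s(2) cInf_lower[OF _ \<open>bdd_below S\<close>] unfolding c_def by force
      then have "AE x in M. x \<in> E \<longrightarrow> s \<le> f x" using zo[OF s(3)] by (auto simp: S_def)
      then show ?thesis by eventually_elim (use s in auto)
    qed
    then show ?thesis unfolding AE_all_countable by blast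
  qed
  ultimately have "AE x in M. x \<in> E \<longrightarrow> f x = c"
  proof eventually_elim
    case (elim x)
    have lim: "(\<lambda>n. 1 / real (Suc n)) \<longlonglongrightarrow> 0" by (rule lim_const_over_n[THEN LIMSEQ_Suc])
    show ?case
    proof
      assume "x \<in> E"
      have "f x \<le> c + 0"
        by (rule LIMSEQ_le_const[OF tendsto_add[OF tendsto_const lim]]) (use elim \<open>x \<in> E\<close> in auto)
      moreover have "c - 0 \<le> f x"
        by (rule LIMSEQ_le_const2[OF tendsto_diff[OF tendsto_const lim]]) (use elim \<open>x \<in> E\<close> in auto)
      ultimately show "f x = c" by simp
    qed
  qed
  then show ?thesis by blast
qed

lemma sum_disjoint_indicators:
  fixes m i :: nat
  assumes "disjoint_family_on F {..<m}" "i < m" "x \<in> F i"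
  shows "(\<Sum>j<m. c j * indicat_real (F j) x) = c i"
proof -
  have "x \<notin> F j" if "j < m" "j \<noteq> i" for j
    using assms that unfolding disjoint_family_on_def by blast
  then have "(\<Sum>j<m. c j * indicat_real (F j) x) = (\<Sum>j<m. if j = i then c j else 0)"
    by (intro sum.cong) (auto simp: indicator_def assms(3))
  then show ?thesis using assms(2) by simp
qed

lemma AE_eq_sum_disjoint_indicators:
  fixes m :: nat
  assumes disj: "disjoint_family_on F {..<m}"
    and c: "\<And>i. i < m \<Longrightarrow> AE x in M. x \<in> F i \<longrightarrow> f x = c i"
    and zero: "AE x in M. x \<notin> (\<Union>i<m. F i) \<longrightarrow> f x = 0"
  shows "AE x in M. f x = (\<Sum>i<m. c i * indicat_real (F i) x)"
proof -
  have "AE x in M. \<forall>i\<in>{..<m}. x \<in> F i \<longrightarrow> f x = c i"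
    by (subst AE_finite_all) (use c in auto)
  then show ?thesis using zero
  proof eventually_elim
    case (elim x)
    show ?case
    proof (cases "x \<in> (\<Union>i<m. F i)")
      case True
      then obtain i where i: "i < m" "x \<in> F i" by auto
      then show ?thesis using elim sum_disjoint_indicators[OF disj i, of c] by simp
    next
      case False
      then show ?thesis using elim by (auto intro!: sum.neutral)
    qed
  qed
qed

text \<open>Non-nullity is expressed through \<open>AE\<close>, so no measurability of the sets has
  to be carried along.\<close>

lemma disjoint_indicators_independent:
  fixes m :: nat
  assumes "disjoint_family_on F {..<m}" "\<And>i. i < m \<Longrightarrow> \<not> (AE x in M. x \<notin> F i)"
    and "AE x in M. (\<Sum>j<m. c j * indicat_real (F j) x) = 0"
  shows "\<forall>j<m. c j = 0"
proof (intro allI impI, rule ccontr)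
  fix i assume i: "i < m" "c i \<noteq> 0"
  have "AE x in M. x \<notin> F i" using assms(3)
  proof eventually_elim
    case (elim x)
    show ?case
    proof
      assume "x \<in> F i"
      then show False using elim i sum_disjoint_indicators[OF assms(1), of i x c] by simp
    qed
  qed
  then show False using assms(2) i by blast
qed

section \<open>Atoms of a finite dimensional space stable under Lipschitz maps\<close>

text \<open>The features of the Besov space from which the atoms are obtained. The condition at 0
  preserves integrability on spaces of infinite measure, and no estimate in terms of
  \<open>L\<close> is recorded.\<close>

locale lipschitz_stable_space =
  fixes M :: "'a measure" and V :: "('a \<Rightarrow> real) set"
  assumes measurable_V: "f \<in> V \<Longrightarrow> f \<in> borel_measurable M"
    and add_V: "f \<in> V \<Longrightarrow> g \<in> V \<Longrightarrow> (\<lambda>x. f x + g x) \<in> V"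
    and zero_V: "(\<lambda>x. 0) \<in> V"
    and cong_AE_V: "f \<in> V \<Longrightarrow> g \<in> borel_measurable M \<Longrightarrow> AE x in M. f x = g x \<Longrightarrow> g \<in> V"
    and lipschitz_V: "f \<in> V \<Longrightarrow> (\<And>s t. \<bar>\<phi> s - \<phi> t\<bar> \<le> L * \<bar>s - t\<bar>) \<Longrightarrow> \<phi> 0 = 0 \<Longrightarrow>
      (\<lambda>x. \<phi> (f x)) \<in> V"
begin

lemma scale_V: "f \<in> V \<Longrightarrow> (\<lambda>x. c * f x) \<in> V"
  by (rule lipschitz_V[where \<phi> = "\<lambda>t. c * t" and L = "\<bar>c\<bar>"])
    (auto simp: abs_mult simp flip: right_diff_distrib)

lemma sum_V:
  fixes k :: nat
  shows "(\<And>i. i < k \<Longrightarrow> b i \<in> V) \<Longrightarrow> (\<lambda>x. \<Sum>i<k. c i * b i x) \<in> V"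
proof (induction k)
  case (Suc k)
  then show ?case using add_V[OF _ scale_V[OF Suc.prems[of k], of "c k"]] by simp
qed (simp add: zero_V)

text \<open>The constant 1 is subtracted inside a Lipschitz map that vanishes at 0, so it does not
  have to belong to \<open>V\<close>.\<close>

lemma indicator_Int_V:
  assumes "indicat_real A \<in> V" "indicat_real B \<in> V"
  shows "indicat_real (A \<inter> B) \<in> V"
proof -
  have "(\<lambda>x. max 0 (indicat_real A x + indicat_real B x - 1)) \<in> V"
    by (rule lipschitz_V[where \<phi> = "\<lambda>t. max 0 (t - 1)" and L = 1, OF add_V[OF assms]]) auto
  moreover have "(\<lambda>x. max 0 (indicat_real A x + indicat_real B x - 1)) = indicat_real (A \<inter> B)"
    by (auto simp: indicator_def fun_eq_iff)
  ultimately show ?thesis by simp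
qed

lemma indicator_Diff_V:
  assumes "indicat_real A \<in> V" "indicat_real B \<in> V"
  shows "indicat_real (A - B) \<in> V"
proof -
  have "(\<lambda>x. max 0 (indicat_real A x + - 1 * indicat_real B x)) \<in> V"
    by (rule lipschitz_V[where \<phi> = "\<lambda>t. max 0 t" and L = 1, OF add_V[OF assms(1) scale_V[OF assms(2)]]]) auto
  moreover have "(\<lambda>x. max 0 (indicat_real A x + - 1 * indicat_real B x)) = indicat_real (A - B)"
    by (auto simp: indicator_def fun_eq_iff)
  ultimately show ?thesis by simp
qed

lemma indicator_Diff_UN_V:
  fixes m :: nat
  assumes "indicat_real A \<in> V" "\<And>i. i < m \<Longrightarrow> indicat_real (F i) \<in> V"
  shows "indicat_real (A - (\<Union>i<m. F i)) \<in> V"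
  using assms(2)
proof (induction m)
  case (Suc m)
  have "A - (\<Union>i<Suc m. F i) = (A - (\<Union>i<m. F i)) - F m" by (auto simp: less_Suc_eq)
  then show ?case using indicator_Diff_V[OF Suc.IH Suc.prems[of m]] Suc.prems by simp
qed (simp add: assms(1))

text \<open>The truncations \<open>min 1 (n (f - s)\<^sup>+)\<close> stay in \<open>V\<close> and converge to the indicator; a finite
  dimensional span is closed under such limits.\<close>

lemma indicator_superlevel_V:
  assumes basis: "ae_basis M V k b" and f: "f \<in> V" and s: "0 < s"
  shows "indicat_real {x. s < f x} \<in> V"
proof -
  define h where "h n x = min 1 (real n * max 0 (f x - s))" for n :: nat and x
  have hV: "h n \<in> V" for n
  proof -
    have "\<bar>min 1 (real n * max 0 (u - s)) - min 1 (real n * max 0 (v - s))\<bar> \<le> real n * \<bar>u - v\<bar>"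
      for u v
    proof -
      have "\<bar>min 1 (real n * max 0 (u - s)) - min 1 (real n * max 0 (v - s))\<bar>
          \<le> \<bar>real n * max 0 (u - s) - real n * max 0 (v - s)\<bar>" by linarith
      also have "\<dots> = real n * \<bar>max 0 (u - s) - max 0 (v - s)\<bar>"
        by (simp add: abs_mult flip: right_diff_distrib)
      also have "\<dots> \<le> real n * \<bar>u - v\<bar>" by (intro mult_left_mono) auto
      finally show ?thesis .
    qed
    \<comment> \<open>Positivity of \<open>s\<close> is what makes the truncating map vanish at
      0.\<close>
    then show ?thesis unfolding h_def
      by (intro lipschitz_V[where \<phi> = "\<lambda>t. min 1 (real n * max 0 (t - s))", OF f]) (use s in auto)
  qed
  then have "\<forall>n. \<exists>c. AE x in M. h n x = (\<Sum>i<k. c i * b i x)"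
    using basis by (auto simp: ae_basis_def)
  then obtain c where c: "\<And>n. AE x in M. h n x = (\<Sum>i<k. c n i * b i x)" by metis
  have lim: "(\<lambda>n. h n x) \<longlonglongrightarrow> indicat_real {x. s < f x} x" for x
  proof (cases "s < f x")
    case True
    have "\<forall>\<^sub>F n in sequentially. h n x = 1"
    proof -
      obtain N where N: "1 / (f x - s) < real N" using reals_Archimedean2 by blast
      have "h n x = 1" if "n \<ge> N" for n
      proof -
        have "1 / (f x - s) \<le> real n" using N that by linarith
        then have "1 \<le> real n * (f x - s)" using True by (simp add: field_simps)
        then show ?thesis using True by (simp add: h_def)
      qed
      then show ?thesis by (auto simp: eventually_sequentially)
    qed
    then show ?thesis using True by (simp add: tendsto_eventually)
  qed (simp add: h_def)
  have "AE x in M. \<forall>n. h n x = (\<Sum>i<k. c n i * b i x)" using c unfolding AE_all_countable by blast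
  then have "AE x in M. (\<lambda>n. \<Sum>i<k. c n i * b i x) \<longlonglongrightarrow> indicat_real {x. s < f x} x"
  proof eventually_elim
    case (elim x)
    then show ?case using lim[of x] by simp
  qed
  from ae_span_closed[OF this] obtain d
    where d: "AE x in M. indicat_real {x. s < f x} x = (\<Sum>i<k. d i * b i x)" by blast
  have bV: "b i \<in> V" if "i < k" for i using basis that by (auto simp: ae_basis_def)
  have [measurable]: "f \<in> borel_measurable M" by (rule measurable_V[OF f])
  have "(\<lambda>x. if s < f x then 1 else 0 :: real) \<in> borel_measurable M" by measurable
  then have "indicat_real {x. s < f x} \<in> borel_measurable M"
    by (simp add: indicator_def[abs_def])
  moreover have "AE x in M. (\<Sum>i<k. d i * b i x) = indicat_real {x. s < f x} x"
    using d by eventually_elim simp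
  ultimately show ?thesis by (intro cong_AE_V[OF sum_V[of k b d, OF bV]])
qed

text \<open>Every conclusion comes from the impossibility of a longer family. A set with indicator
  in \<open>V\<close> can neither stick out of the union nor cut a member properly, and superlevel
  sets transfer this rigidity from sets to functions.\<close>

theorem atoms_of_finite_dimensional:
  assumes dim: "has_ae_dim M V k"
  obtains E :: "nat \<Rightarrow> 'a set" where
    "disjoint_family_on E {..<k}"
    "\<And>i. i < k \<Longrightarrow> indicat_real (E i) \<in> V"
    "\<And>i. i < k \<Longrightarrow> \<not> (AE x in M. x \<notin> E i)"
    "\<And>f i. f \<in> V \<Longrightarrow> i < k \<Longrightarrow> \<exists>c. AE x in M. x \<in> E i \<longrightarrow> f x = c"
    "\<And>f. f \<in> V \<Longrightarrow> AE x in M. x \<notin> (\<Union>i<k. E i) \<longrightarrow> f x = 0"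
    "ae_basis M V k (\<lambda>i. indicat_real (E i))"
proof -
  obtain b where b: "ae_basis M V k b" using dim by (auto simp: has_ae_dim_def)
  define fam where "fam F m \<longleftrightarrow> disjoint_family_on F {..<m} \<and>
    (\<forall>i<m. indicat_real (F i) \<in> V \<and> \<not> (AE x in M. x \<notin> F i))" for F :: "nat \<Rightarrow> 'a set" and m
  have famI: "disjoint_family_on F {..<m}" if "fam F m" for F m using that by (simp add: fam_def)
  have fam_le: "m \<le> k" if "fam F m" for F m
  proof (rule ae_independent_card_le[where w = "\<lambda>i. indicat_real (F i)" and b = b and M = M])
    show "\<exists>c. AE x in M. indicat_real (F j) x = (\<Sum>i<k. c i * b i x)" if "j < m" for j
      using b \<open>fam F m\<close> that by (auto simp: ae_basis_def fam_def)
  next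
    fix c assume "AE x in M. (\<Sum>j<m. c j * indicat_real (F j) x) = 0"
    then show "\<forall>j<m. c j = 0"
      using disjoint_indicators_independent[of F m M c] that by (simp add: fam_def)
  qed
  define m where "m = (GREATEST m. \<exists>F. fam F m)"
  have ex0: "\<exists>F. fam F 0" by (auto simp: fam_def disjoint_family_on_def)
  have "\<exists>F. fam F m"
    unfolding m_def by (rule GreatestI_nat[where P = "\<lambda>m. \<exists>F. fam F m" and b = k, OF ex0]) (use fam_le in blast)
  then obtain E where E: "fam E m" by blast
  have max: "\<not> fam F (Suc m)" for F
    using Greatest_le_nat[of "\<lambda>m. \<exists>F. fam F m" "Suc m" k] fam_le unfolding m_def[symmetric] by force
  have EV: "indicat_real (E i) \<in> V" "\<not> (AE x in M. x \<notin> E i)" if "i < m" for i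
    using E that by (auto simp: fam_def)
  have disj: "E i \<inter> E j = {}" if "i < m" "j < m" "i \<noteq> j" for i j
    using E that by (auto simp: fam_def disjoint_family_on_def)
  \<comment> \<open>If \<open>A\<close> left the union on a non-null set, the leftover could be
    appended as member \<open>m\<close>.\<close>
  have off: "AE x in M. x \<in> A \<longrightarrow> x \<in> (\<Union>i<m. E i)" if A: "indicat_real A \<in> V" for A
  proof (rule ccontr)
    assume *: "\<not> ?thesis"
    have "fam (E(m := A - (\<Union>i<m. E i))) (Suc m)"
      unfolding fam_def
    proof (intro conjI allI impI)
      show "disjoint_family_on (E(m := A - (\<Union>i<m. E i))) {..<Suc m}"
        unfolding disjoint_family_on_def
      proof (intro ballI impI)
        fix a b assume "a \<in> {..<Suc m}" "b \<in> {..<Suc m}" "a \<noteq> b"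
        then consider "a < m" "b < m" "a \<noteq> b" | "a < m" "b = m" | "a = m" "b < m" by force
        then show "(E(m := A - (\<Union>i<m. E i))) a \<inter> (E(m := A - (\<Union>i<m. E i))) b = {}"
          by cases (use disj[of a b] in auto)
      qed
    next
      fix i assume "i < Suc m"
      show "indicat_real ((E(m := A - (\<Union>i<m. E i))) i) \<in> V"
        using \<open>i < Suc m\<close> EV indicator_Diff_UN_V[OF A, of m E] by (cases "i = m") auto
      show "\<not> (AE x in M. x \<notin> (E(m := A - (\<Union>i<m. E i))) i)"
        using \<open>i < Suc m\<close> EV * by (cases "i = m") auto
    qed
    then show False using max by blast
  qed
  \<comment> \<open>If \<open>A\<close> cut \<open>E i\<close> into two non-null parts, one would
    keep position \<open>i\<close> and the other would take the new position
    \<open>m\<close>.\<close>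
  have zo: "(AE x in M. x \<in> E i \<longrightarrow> x \<notin> A) \<or> (AE x in M. x \<in> E i \<longrightarrow> x \<in> A)"
    if A: "indicat_real A \<in> V" and i: "i < m" for A i
  proof (rule ccontr)
    assume *: "\<not> ?thesis"
    have "fam (E(i := E i \<inter> A, m := E i - A)) (Suc m)"
      unfolding fam_def
    proof (intro conjI allI impI)
      show "disjoint_family_on (E(i := E i \<inter> A, m := E i - A)) {..<Suc m}"
        unfolding disjoint_family_on_def
      proof (intro ballI impI)
        fix a b assume "a \<in> {..<Suc m}" "b \<in> {..<Suc m}" "a \<noteq> b"
        then consider "a < m" "b < m" "a \<noteq> b" | "a < m" "b = m" | "a = m" "b < m" by force
        then show "(E(i := E i \<inter> A, m := E i - A)) a \<inter> (E(i := E i \<inter> A, m := E i - A)) b = {}"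
          by cases (use disj[of a b] disj[of a i] disj[of i b] i in auto)
      qed
    next
      fix j assume "j < Suc m"
      show "indicat_real ((E(i := E i \<inter> A, m := E i - A)) j) \<in> V"
        using \<open>j < Suc m\<close> EV i indicator_Diff_V[OF EV(1)[OF i] A] indicator_Int_V[OF EV(1)[OF i] A]
        by auto
      show "\<not> (AE x in M. x \<notin> (E(i := E i \<inter> A, m := E i - A)) j)"
        using \<open>j < Suc m\<close> EV i * by auto
    qed
    then show False using max by blast
  qed
  have const: "\<exists>c. AE x in M. x \<in> E i \<longrightarrow> f x = c" if f: "f \<in> V" and i: "i < m" for f i
  proof (rule ae_constant_on_if_zero_one[OF EV(2)[OF i]])
    fix s :: real assume "s \<noteq> 0"
    then consider "s > 0" | "- s > 0" by linarith
    then show "(AE x in M. x \<in> E i \<longrightarrow> f x \<le> s) \<or> (AE x in M. x \<in> E i \<longrightarrow> s \<le> f x)"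
    proof cases
      case 1
      show ?thesis using zo[OF indicator_superlevel_V[OF b f 1] i]
      proof
        assume "AE x in M. x \<in> E i \<longrightarrow> x \<notin> {x. s < f x}"
        then have "AE x in M. x \<in> E i \<longrightarrow> f x \<le> s" by eventually_elim auto
        then show ?thesis ..
      next
        assume "AE x in M. x \<in> E i \<longrightarrow> x \<in> {x. s < f x}"
        then have "AE x in M. x \<in> E i \<longrightarrow> s \<le> f x" by eventually_elim auto
        then show ?thesis ..
      qed
    next
      case 2
      show ?thesis using zo[OF indicator_superlevel_V[OF b scale_V[OF f, of "-1"] 2] i]
      proof
        assume "AE x in M. x \<in> E i \<longrightarrow> x \<notin> {x. - s < - 1 * f x}"
        then have "AE x in M. x \<in> E i \<longrightarrow> s \<le> f x" by eventually_elim auto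
        then show ?thesis ..
      next
        assume "AE x in M. x \<in> E i \<longrightarrow> x \<in> {x. - s < - 1 * f x}"
        then have "AE x in M. x \<in> E i \<longrightarrow> f x \<le> s" by eventually_elim auto
        then show ?thesis ..
      qed
    qed
  qed
  have zero: "AE x in M. x \<notin> (\<Union>i<m. E i) \<longrightarrow> f x = 0" if f: "f \<in> V" for f
  proof -
    \<comment> \<open>The levels \<open>1 / real (Suc n)\<close> exhaust the set where
      \<open>g\<close> is positive; using this for \<open>f\<close> and for \<open>- f\<close> gives
      vanishing.\<close>
    have *: "AE x in M. x \<notin> (\<Union>i<m. E i) \<longrightarrow> g x \<le> 0" if g: "g \<in> V" for g
    proof -
      have "AE x in M. 1 / real (Suc n) < g x \<longrightarrow> x \<in> (\<Union>i<m. E i)" for n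
        using off[OF indicator_superlevel_V[OF b g, of "1 / real (Suc n)"]] by simp
      then have "AE x in M. \<forall>n. 1 / real (Suc n) < g x \<longrightarrow> x \<in> (\<Union>i<m. E i)"
        unfolding AE_all_countable by blast
      then show ?thesis
      proof eventually_elim
        case (elim x)
        then show ?case using nat_approx_posE[of "g x"] by (metis not_le)
      qed
    qed
    show ?thesis using *[OF f] *[OF scale_V[OF f, of "-1"]] by eventually_elim auto
  qed
  have basis: "ae_basis M V m (\<lambda>i. indicat_real (E i))"
    unfolding ae_basis_def
  proof (intro conjI allI impI ballI)
    fix c i assume "AE x in M. (\<Sum>i<m. c i * indicat_real (E i) x) = 0" "i < m"
    then show "c i = 0" using disjoint_indicators_independent[of E m M c] E by (auto simp: fam_def)
  next
    fix f assume f: "f \<in> V"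
    obtain c where c: "\<And>i. i < m \<Longrightarrow> AE x in M. x \<in> E i \<longrightarrow> f x = c i"
      using const[OF f] by metis
    have "AE x in M. f x = (\<Sum>i<m. c i * indicat_real (E i) x)"
      by (rule AE_eq_sum_disjoint_indicators[OF famI[OF E] c zero[OF f]])
    then show "\<exists>c. AE x in M. f x = (\<Sum>i<m. c i * indicat_real (E i) x)" by blast
  qed (use EV in auto)
  \<comment> \<open>The given basis is independent and lies in the span of the indicators, so the
    counting bound applies in the reverse direction too.\<close>
  have "k \<le> m"
    by (rule ae_independent_card_le[where w = b and b = "\<lambda>i. indicat_real (E i)" and M = M])
      (use basis b in \<open>auto simp: ae_basis_def\<close>)
  with fam_le[OF E] have "m = k" by simp
  show ?thesis
    by (rule that[of E]) (use famI[OF E] EV const zero basis in \<open>simp_all add: \<open>m = k\<close>\<close>)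
qed

end

section \<open>Estimates in L^p and for upper limits\<close>

lemma ennreal_inverse_antimono:
  fixes a b :: ennreal
  shows "a \<le> b \<Longrightarrow> inverse b \<le> inverse a"
  including ennreal.lifting by transfer (rule ereal_inverse_antimono)

text \<open>The crude factor comes from \<open>a + b \<le> 2 * max a b\<close>; only finiteness of
  integrals is at stake.\<close>

lemma powr_add_le:
  fixes a b p :: real
  assumes "0 \<le> a" "0 \<le> b" "0 \<le> p"
  shows "(a + b) powr p \<le> 2 powr p * (a powr p + b powr p)"
proof -
  have "(a + b) powr p \<le> (2 * max a b) powr p"
    using assms by (intro powr_mono2) auto
  also have "\<dots> = 2 powr p * max a b powr p" using assms by (simp add: powr_mult)
  also have "\<dots> \<le> 2 powr p * (a powr p + b powr p)"
    by (intro mult_left_mono) (auto simp: max_def)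
  finally show ?thesis .
qed

lemma Lp_fun_iff:
  "u \<in> Lp_fun N p \<longleftrightarrow> u \<in> borel_measurable N \<and> (\<integral>\<^sup>+x. ennreal (\<bar>u x\<bar> powr p) \<partial>N) < \<infinity>"
  by (simp add: Lp_fun_def)

lemma nn_integral_powr_le:
  assumes "AE x in N. \<bar>g x\<bar> \<le> L * \<bar>f x\<bar>" "f \<in> borel_measurable N" "0 \<le> p" "0 \<le> L"
  shows "(\<integral>\<^sup>+x. ennreal (\<bar>g x\<bar> powr p) \<partial>N) \<le> ennreal (L powr p) * (\<integral>\<^sup>+x. ennreal (\<bar>f x\<bar> powr p) \<partial>N)"
proof -
  have [measurable]: "f \<in> borel_measurable N" by fact
  have "(\<integral>\<^sup>+x. ennreal (\<bar>g x\<bar> powr p) \<partial>N) \<le> (\<integral>\<^sup>+x. ennreal (L powr p) * ennreal (\<bar>f x\<bar> powr p) \<partial>N)"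
  proof (rule nn_integral_mono_AE, use assms(1) in eventually_elim)
    case (elim x)
    have "\<bar>g x\<bar> powr p \<le> (L * \<bar>f x\<bar>) powr p" using elim assms by (intro powr_mono2) auto
    then show ?case using assms by (simp add: powr_mult flip: ennreal_mult')
  qed
  also have "\<dots> = ennreal (L powr p) * (\<integral>\<^sup>+x. ennreal (\<bar>f x\<bar> powr p) \<partial>N)"
    by (rule nn_integral_cmult) measurable
  finally show ?thesis .
qed

text \<open>Applied to functions on the space and to increments on the product, it reduces Lipschitz
  maps, truncations and changes on null sets to pointwise estimates.\<close>

lemma Lp_fun_dominated:
  assumes f: "f \<in> Lp_fun N p" and g: "g \<in> borel_measurable N"
    and le: "AE x in N. \<bar>g x\<bar> \<le> L * \<bar>f x\<bar>" and p: "0 \<le> p"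
  shows "g \<in> Lp_fun N p"
proof -
  have "AE x in N. \<bar>g x\<bar> \<le> \<bar>L\<bar> * \<bar>f x\<bar>"
    using le by eventually_elim (smt (verit) mult_right_mono abs_ge_zero abs_ge_self)
  then have "(\<integral>\<^sup>+x. ennreal (\<bar>g x\<bar> powr p) \<partial>N)
      \<le> ennreal (\<bar>L\<bar> powr p) * (\<integral>\<^sup>+x. ennreal (\<bar>f x\<bar> powr p) \<partial>N)"
    using f p by (intro nn_integral_powr_le) (auto simp: Lp_fun_iff)
  also have "\<dots> < \<infinity>" using f by (simp add: Lp_fun_iff ennreal_mult_less_top)
  finally show ?thesis using g by (simp add: Lp_fun_iff)
qed

lemma Lp_fun_add:
  assumes f: "f \<in> Lp_fun N p" and g: "g \<in> Lp_fun N p" and p: "0 \<le> p"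
  shows "(\<lambda>x. f x + g x) \<in> Lp_fun N p"
proof -
  have [measurable]: "f \<in> borel_measurable N" "g \<in> borel_measurable N"
    using f g by (auto simp: Lp_fun_iff)
  have "(\<integral>\<^sup>+x. ennreal (\<bar>f x + g x\<bar> powr p) \<partial>N)
      \<le> (\<integral>\<^sup>+x. ennreal (2 powr p) * (ennreal (\<bar>f x\<bar> powr p) + ennreal (\<bar>g x\<bar> powr p)) \<partial>N)"
  proof (rule nn_integral_mono)
    fix x
    have "\<bar>f x + g x\<bar> powr p \<le> (\<bar>f x\<bar> + \<bar>g x\<bar>) powr p" using p by (intro powr_mono2) auto
    also have "\<dots> \<le> 2 powr p * (\<bar>f x\<bar> powr p + \<bar>g x\<bar> powr p)" by (rule powr_add_le) (use p in auto)
    finally show "ennreal (\<bar>f x + g x\<bar> powr p)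
        \<le> ennreal (2 powr p) * (ennreal (\<bar>f x\<bar> powr p) + ennreal (\<bar>g x\<bar> powr p))"
      by (simp flip: ennreal_mult' ennreal_plus)
  qed
  also have "\<dots> = ennreal (2 powr p) *
      ((\<integral>\<^sup>+x. ennreal (\<bar>f x\<bar> powr p) \<partial>N) + (\<integral>\<^sup>+x. ennreal (\<bar>g x\<bar> powr p) \<partial>N))"
    by (subst nn_integral_cmult, measurable, subst nn_integral_add, measurable)
  also have "\<dots> < \<infinity>" using f g by (simp add: Lp_fun_iff ennreal_mult_less_top)
  finally show ?thesis by (simp add: Lp_fun_iff)
qed

lemma Lp_fun_cmult:
  assumes "f \<in> Lp_fun N p" "0 \<le> p"
  shows "(\<lambda>x. c * f x) \<in> Lp_fun N p"
  by (rule Lp_fun_dominated[OF assms(1), where L = "\<bar>c\<bar>"])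
    (use assms in \<open>auto simp: Lp_fun_iff abs_mult\<close>)

text \<open>This discards the error term when Korevaar-Schoen energies are compared. An infinite
  upper limit is trivial; a finite one can be exceeded strictly by half of the tolerance, and the
  remainder uses up the other half.\<close>

lemma Limsup_add_tendsto_0_le:
  fixes a h r :: "'b \<Rightarrow> ennreal"
  assumes "\<forall>\<^sub>F t in F. h t \<le> a t + r t" and r: "(r \<longlongrightarrow> 0) F"
  shows "Limsup F h \<le> Limsup F a"
proof (rule ennreal_le_epsilon)
  fix e :: real assume fin: "Limsup F a < top" and e: "0 < e"
  have "Limsup F a < Limsup F a + ennreal (e / 2)"
    using fin e by (simp add: ennreal_add_left_cancel_less[of _ 0, simplified])
  then have "\<forall>\<^sub>F t in F. a t < Limsup F a + ennreal (e / 2)" by (rule Limsup_lessD)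
  moreover have "\<forall>\<^sub>F t in F. r t < ennreal (e / 2)" using r e by (intro order_tendstoD) auto
  ultimately have "\<forall>\<^sub>F t in F. h t \<le> Limsup F a + ennreal e"
    using assms(1)
  proof eventually_elim
    case (elim t)
    have "h t \<le> (Limsup F a + ennreal (e / 2)) + ennreal (e / 2)"
      using elim by (meson add_mono less_imp_le order_trans)
    also have "\<dots> = Limsup F a + ennreal e" using e by (simp add: add.assoc flip: ennreal_plus)
    finally show ?case .
  qed
  then show "Limsup F h \<le> Limsup F a + ennreal e" by (rule Limsup_bounded)
qed

section \<open>Metric measure spaces and measurability\<close>

text \<open>Separability is carried by second countability of the type. It makes the distance
  measurable for the product sigma-algebra, and unit balls around a countable dense set give
  sigma-finiteness and with it Tonelli's theorem.\<close>

locale metric_measure_space =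
  fixes M :: "'a::{metric_space, second_countable_topology} measure"
  assumes sets_M [measurable_cong]: "sets M = sets borel"
    and emeasure_ball_pos: "0 < r \<Longrightarrow> 0 < emeasure M (ball x r)"
    and emeasure_ball_finite: "0 < r \<Longrightarrow> emeasure M (ball x r) < \<infinity>"
begin

lemma space_M [simp]: "space M = UNIV"
  using sets_eq_imp_space_eq[OF sets_M] by simp

sublocale sigma_finite_measure M
proof
  obtain D :: "'a set" where D: "countable D" "\<And>X. open X \<Longrightarrow> X \<noteq> {} \<Longrightarrow> \<exists>d\<in>D. d \<in> X"
    using countable_dense_exists by metis
  have "x \<in> (\<Union>d\<in>D. ball d 1)" for x :: 'a
    using D(2)[of "ball x 1"] by (auto simp: dist_commute)
  then show "\<exists>A. countable A \<and> A \<subseteq> sets M \<and> \<Union>A = space M \<and> (\<forall>a\<in>A. emeasure M a \<noteq> \<infinity>)"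
    using D(1) emeasure_ball_finite[of 1]
    by (intro exI[of _ "(\<lambda>d. ball d 1) ` D"]) (auto simp: sets_M less_top)
qed

sublocale pair: pair_sigma_finite M M ..

text \<open>The ball is a section of the measurable set \<open>Q\<close> in the product, and
  measures of sections depend measurably on the base point.\<close>

lemma measurable_emeasure_ball [measurable (raw)]:
  assumes [measurable]: "f \<in> N \<rightarrow>\<^sub>M M" "r \<in> borel_measurable N"
  shows "(\<lambda>w. emeasure M (ball (f w) (r w))) \<in> borel_measurable N"
proof -
  have [measurable]: "f \<in> borel_measurable N" using assms(1) measurable_cong_sets[OF refl sets_M] by blast
  have [measurable]: "snd \<in> borel_measurable (N \<Otimes>\<^sub>M M)"
    using measurable_snd[of N M] measurable_cong_sets[OF refl sets_M] by blast
  define Q where "Q = {z \<in> space (N \<Otimes>\<^sub>M M). dist (f (fst z)) (snd z) < r (fst z)}"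
  have "Q \<in> sets (N \<Otimes>\<^sub>M M)" unfolding Q_def by measurable
  then have "(\<lambda>w. emeasure M (Pair w -` Q)) \<in> borel_measurable N" by (rule measurable_emeasure_Pair)
  moreover have "Pair w -` Q = ball (f w) (r w)" if "w \<in> space N" for w
    using that by (auto simp: Q_def space_pair_measure)
  ultimately show ?thesis by (subst measurable_cong[where g = "\<lambda>w. emeasure M (Pair w -` Q)"]) auto
qed

lemma measurable_dist_pair [measurable]:
  "(\<lambda>z. dist (fst z) (snd z)) \<in> borel_measurable (M \<Otimes>\<^sub>M M)"
proof -
  have "fst \<in> borel_measurable (M \<Otimes>\<^sub>M M)" "snd \<in> borel_measurable (M \<Otimes>\<^sub>M M)"
    using measurable_fst[of M M] measurable_snd[of M M] measurable_cong_sets[OF refl sets_M] by blast+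
  then show ?thesis by measurable
qed

section \<open>The Besov space through increments\<close>

text \<open>The parameter \<open>q\<close> stands for \<open>\<theta> * p\<close>. The diagonal is
  singled out by distance 0 rather than by equality of points, so that measurability follows from
  that of the distance.\<close>

definition kernel :: "real \<Rightarrow> 'a \<times> 'a \<Rightarrow> ennreal" where
  "kernel q z = (if dist (fst z) (snd z) = 0 then 0 else
     inverse (ennreal (dist (fst z) (snd z) powr q) * emeasure M (ball (fst z) (dist (fst z) (snd z)))))"

lemma measurable_kernel [measurable]: "kernel q \<in> borel_measurable (M \<Otimes>\<^sub>M M)"
  unfolding kernel_def[abs_def] by measurable

text \<open>With respect to \<open>besov_measure q\<close> the Besov energy is the \<open>p\<close>-th power of the \<open>L\<^sup>p\<close> norm of
  the increments \<open>u y - u x\<close>.\<close>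

definition besov_measure :: "real \<Rightarrow> ('a \<times> 'a) measure" where
  "besov_measure q = density (M \<Otimes>\<^sub>M M) (kernel q)"

definition increment :: "('a \<Rightarrow> real) \<Rightarrow> 'a \<times> 'a \<Rightarrow> real" where
  "increment u z = u (snd z) - u (fst z)"

lemma measurable_increment [measurable (raw)]:
  "u \<in> borel_measurable M \<Longrightarrow> increment u \<in> borel_measurable (M \<Otimes>\<^sub>M M)"
  unfolding increment_def[abs_def]
  by (intro borel_measurable_diff measurable_compose[OF measurable_snd] measurable_compose[OF measurable_fst])

lemma measurable_besov_measure [simp]: "measurable (besov_measure q) N = measurable (M \<Otimes>\<^sub>M M) N"
  by (rule measurable_cong_sets) (simp_all add: besov_measure_def)

lemma nn_integral_besov_measure:
  assumes [measurable]: "h \<in> borel_measurable (M \<Otimes>\<^sub>M M)"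
  shows "(\<integral>\<^sup>+z. h z \<partial>besov_measure q) = (\<integral>\<^sup>+x. \<integral>\<^sup>+y. kernel q (x, y) * h (x, y) \<partial>M \<partial>M)"
proof -
  have "(\<integral>\<^sup>+z. h z \<partial>besov_measure q) = (\<integral>\<^sup>+z. kernel q z * h z \<partial>(M \<Otimes>\<^sub>M M))"
    unfolding besov_measure_def by (rule nn_integral_density) measurable
  also have "\<dots> = (\<integral>\<^sup>+x. \<integral>\<^sup>+y. kernel q (x, y) * h (x, y) \<partial>M \<partial>M)"
    by (rule nn_integral_fst[symmetric]) measurable
  finally show ?thesis .
qed

lemma besov_energy_eq:
  assumes [measurable]: "u \<in> borel_measurable M"
  shows "besov_energy M p \<theta> u = (\<integral>\<^sup>+z. ennreal (\<bar>increment u z\<bar> powr p) \<partial>besov_measure (\<theta> * p))"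
proof -
  have "(\<integral>\<^sup>+z. ennreal (\<bar>increment u z\<bar> powr p) \<partial>besov_measure (\<theta> * p))
      = (\<integral>\<^sup>+x. \<integral>\<^sup>+y. kernel (\<theta> * p) (x, y) * ennreal (\<bar>increment u (x, y)\<bar> powr p) \<partial>M \<partial>M)"
    by (rule nn_integral_besov_measure) measurable
  also have "\<dots> = besov_energy M p \<theta> u"
    unfolding besov_energy_def
    by (intro nn_integral_cong) (auto simp: kernel_def increment_def divide_ennreal_def mult.commute)
  finally show ?thesis ..
qed

text \<open>Since \<open>increment\<close> is linear and contracts under Lipschitz maps up to the
  Lipschitz constant, the closure properties of the Besov space reduce to those of L^p for two
  measures.\<close>

lemma besov_iff:
  "u \<in> besov M p \<theta> \<longleftrightarrow> u \<in> Lp_fun M p \<and> increment u \<in> Lp_fun (besov_measure (\<theta> * p)) p"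
  by (auto simp: besov_def besov_energy_eq Lp_fun_iff)

lemma AE_pair_fst_snd:
  assumes [measurable]: "Measurable.pred M P" and "AE x in M. P x"
  shows "AE z in M \<Otimes>\<^sub>M M. P (fst z) \<and> P (snd z)"
proof (rule pair.AE_pair_measure)
  show "AE x in M. AE y in M. P (fst (x, y)) \<and> P (snd (x, y))"
    using assms(2)
  proof eventually_elim
    case (elim x)
    show ?case using assms(2) by eventually_elim (use elim in simp)
  qed
qed measurable

lemma AE_besov_measureI: "AE z in M \<Otimes>\<^sub>M M. P z \<Longrightarrow> AE z in besov_measure q. P z"
  unfolding besov_measure_def AE_density[OF measurable_kernel] by (erule eventually_mono) simp

lemma besov_measurable: "f \<in> besov M p \<theta> \<Longrightarrow> f \<in> borel_measurable M"
  by (simp add: besov_iff Lp_fun_iff)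

lemma besov_add:
  assumes "f \<in> besov M p \<theta>" "g \<in> besov M p \<theta>" "0 \<le> p"
  shows "(\<lambda>x. f x + g x) \<in> besov M p \<theta>"
proof -
  have "(\<lambda>z. increment f z + increment g z) \<in> Lp_fun (besov_measure (\<theta> * p)) p"
    using assms by (intro Lp_fun_add) (auto simp: besov_iff)
  moreover have "(\<lambda>z. increment f z + increment g z) = increment (\<lambda>x. f x + g x)"
    by (auto simp: increment_def)
  ultimately show ?thesis using assms by (simp add: besov_iff Lp_fun_add)
qed

lemma besov_cong_AE:
  assumes f: "f \<in> besov M p \<theta>" and g [measurable]: "g \<in> borel_measurable M"
    and eq: "AE x in M. f x = g x" and p: "0 \<le> p"
  shows "g \<in> besov M p \<theta>"
proof -
  have [measurable]: "f \<in> borel_measurable M" using f by (rule besov_measurable)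
  have "g \<in> Lp_fun M p"
  proof (rule Lp_fun_dominated[where f = f and L = 1])
    show "AE x in M. \<bar>g x\<bar> \<le> 1 * \<bar>f x\<bar>" using eq by eventually_elim simp
  qed (use f p g in \<open>simp_all add: besov_iff\<close>)
  moreover have "AE z in M \<Otimes>\<^sub>M M. f (fst z) = g (fst z) \<and> f (snd z) = g (snd z)"
    using eq by (intro AE_pair_fst_snd) measurable
  then have "AE z in besov_measure (\<theta> * p). \<bar>increment g z\<bar> \<le> 1 * \<bar>increment f z\<bar>"
    by (intro AE_besov_measureI, elim eventually_mono) (simp add: increment_def)
  then have "increment g \<in> Lp_fun (besov_measure (\<theta> * p)) p"
    by (rule Lp_fun_dominated[rotated 2])
      (use f g p in \<open>simp_all add: besov_iff measurable_increment\<close>)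
  ultimately show ?thesis by (simp add: besov_iff)
qed

lemma besov_lipschitz:
  assumes f: "f \<in> besov M p \<theta>" and lip: "\<And>s t. \<bar>\<phi> s - \<phi> t\<bar> \<le> L * \<bar>s - t\<bar>"
    and "\<phi> 0 = 0" and p: "0 \<le> p"
  shows "(\<lambda>x. \<phi> (f x)) \<in> besov M p \<theta>"
proof -
  have [measurable]: "f \<in> borel_measurable M" using f by (rule besov_measurable)
  have "L-lipschitz_on UNIV \<phi>"
  proof (rule lipschitz_onI)
    show "0 \<le> L" using lip[of 1 0] by simp
  qed (simp add: dist_real_def lip)
  then have "continuous_on UNIV \<phi>" by (rule lipschitz_on_continuous_on)
  then have [measurable]: "\<phi> \<in> borel_measurable borel" by (rule borel_measurable_continuous_onI)
  have "(\<lambda>x. \<phi> (f x)) \<in> Lp_fun M p"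
  proof (rule Lp_fun_dominated[where f = f and L = L])
    show "AE x in M. \<bar>\<phi> (f x)\<bar> \<le> L * \<bar>f x\<bar>"
      using lip[of _ 0] \<open>\<phi> 0 = 0\<close> by (intro AE_I2) (metis diff_zero)
    show "(\<lambda>x. \<phi> (f x)) \<in> borel_measurable M" by measurable
  qed (use f p in \<open>simp_all add: besov_iff\<close>)
  moreover have "increment (\<lambda>x. \<phi> (f x)) \<in> Lp_fun (besov_measure (\<theta> * p)) p"
  proof (rule Lp_fun_dominated[where f = "increment f" and L = L])
    show "AE z in besov_measure (\<theta> * p). \<bar>increment (\<lambda>x. \<phi> (f x)) z\<bar> \<le> L * \<bar>increment f z\<bar>"
      by (intro AE_I2) (simp add: increment_def lip)
    show "increment (\<lambda>x. \<phi> (f x)) \<in> borel_measurable (besov_measure (\<theta> * p))" by simp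
  qed (use f p in \<open>simp_all add: besov_iff\<close>)
  ultimately show ?thesis by (simp add: besov_iff)
qed

lemma lipschitz_stable_besov:
  assumes p: "0 \<le> p"
  shows "lipschitz_stable_space M (besov M p \<theta>)"
proof (rule lipschitz_stable_space.intro)
  show "(\<lambda>x. 0) \<in> besov M p \<theta>" by (simp add: besov_iff Lp_fun_iff increment_def[abs_def])
qed (fact besov_measurable, fact besov_add[OF _ _ p], fact besov_cong_AE[OF _ _ _ p],
    fact besov_lipschitz[OF _ _ _ p])

section \<open>Restriction to a measurable piece\<close>

lemma measurable_cut_off:
  assumes "f \<in> borel_measurable (restrict_space M E)" "E \<in> sets M"
  shows "(\<lambda>x. indicat_real E x * f x) \<in> borel_measurable M"
  using assms by (simp add: borel_measurable_restrict_space_iff)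

text \<open>Balls of the piece are smaller than balls of the whole space, so the kernel of the piece
  is the larger one and its energy controls the ambient energy over \<open>E \<times> E\<close>.
  Pairs with exactly one point in \<open>E\<close> are left out here.\<close>

lemma besov_restrict_cut_off:
  assumes f: "f \<in> besov (restrict_space M E) p \<theta>" and E: "E \<in> sets M"
  shows "(\<lambda>x. indicat_real E x * f x) \<in> Lp_fun M p"
    and "(\<lambda>z. indicat_real (E \<times> E) z * increment (\<lambda>x. indicat_real E x * f x) z)
      \<in> Lp_fun (besov_measure (\<theta> * p)) p"
proof -
  define g where "g x = indicat_real E x * f x" for x
  define G where "G z = indicat_real (E \<times> E) z * increment g z" for z
  have g [measurable]: "g \<in> borel_measurable M"
    using measurable_cut_off[of f E] f E unfolding g_def by (simp add: besov_def Lp_fun_def)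
  have [measurable]: "E \<in> sets M" by fact
  have G [measurable]: "G \<in> borel_measurable (M \<Otimes>\<^sub>M M)" unfolding G_def[abs_def] by measurable
  have "(\<integral>\<^sup>+x. ennreal (\<bar>g x\<bar> powr p) \<partial>M) \<le> (\<integral>\<^sup>+x. ennreal (\<bar>f x\<bar> powr p) \<partial>restrict_space M E)"
    using E by (subst nn_integral_restrict_space)
      (auto simp: g_def indicator_def intro!: nn_integral_mono)
  also have "\<dots> < \<infinity>" using f by (simp add: besov_def Lp_fun_def)
  finally show "(\<lambda>x. indicat_real E x * f x) \<in> Lp_fun M p"
    using g unfolding g_def by (simp add: Lp_fun_iff)
  have "(\<integral>\<^sup>+z. ennreal (\<bar>G z\<bar> powr p) \<partial>besov_measure (\<theta> * p))
      = (\<integral>\<^sup>+x. \<integral>\<^sup>+y. kernel (\<theta> * p) (x, y) * ennreal (\<bar>G (x, y)\<bar> powr p) \<partial>M \<partial>M)"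
    by (rule nn_integral_besov_measure) measurable
  also have "\<dots> \<le> besov_energy (restrict_space M E) p \<theta> f"
    unfolding besov_energy_def
  proof (subst nn_integral_restrict_space)
    show "E \<inter> space M \<in> sets M" using E by simp
    show "(\<integral>\<^sup>+x. \<integral>\<^sup>+y. kernel (\<theta> * p) (x, y) * ennreal (\<bar>G (x, y)\<bar> powr p) \<partial>M \<partial>M) \<le>
      (\<integral>\<^sup>+x. (\<integral>\<^sup>+y. (if x = y then 0 else
        ennreal (\<bar>f y - f x\<bar> powr p) /
          (ennreal (dist x y powr (\<theta> * p)) * emeasure (restrict_space M E)
            (ball x (dist x y) \<inter> space (restrict_space M E)))) \<partial>restrict_space M E) * indicator E x \<partial>M)"
    proof (intro nn_integral_mono)
      fix x
      show "(\<integral>\<^sup>+y. kernel (\<theta> * p) (x, y) * ennreal (\<bar>G (x, y)\<bar> powr p) \<partial>M) \<le>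
        (\<integral>\<^sup>+y. (if x = y then 0 else
          ennreal (\<bar>f y - f x\<bar> powr p) /
            (ennreal (dist x y powr (\<theta> * p)) * emeasure (restrict_space M E)
              (ball x (dist x y) \<inter> space (restrict_space M E)))) \<partial>restrict_space M E) * indicator E x"
      proof (cases "x \<in> E")
        case False
        then show ?thesis by (simp add: G_def)
      next
        case True
        have "(\<integral>\<^sup>+y. kernel (\<theta> * p) (x, y) * ennreal (\<bar>G (x, y)\<bar> powr p) \<partial>M)
          \<le> (\<integral>\<^sup>+y. (if x = y then 0 else
          ennreal (\<bar>f y - f x\<bar> powr p) /
            (ennreal (dist x y powr (\<theta> * p)) * emeasure (restrict_space M E)
              (ball x (dist x y) \<inter> space (restrict_space M E)))) \<partial>restrict_space M E)"
        proof (subst nn_integral_restrict_space)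
          show "(\<integral>\<^sup>+y. kernel (\<theta> * p) (x, y) * ennreal (\<bar>G (x, y)\<bar> powr p) \<partial>M) \<le>
            (\<integral>\<^sup>+y. (if x = y then 0 else
              ennreal (\<bar>f y - f x\<bar> powr p) /
                (ennreal (dist x y powr (\<theta> * p)) * emeasure (restrict_space M E)
                  (ball x (dist x y) \<inter> space (restrict_space M E)))) * indicator E y \<partial>M)"
          proof (intro nn_integral_mono)
            fix y
            \<comment> \<open>The trace of the ball on \<open>E\<close> may be null; its inverse is
              then infinite and the comparison of inverses still holds.\<close>
            have "emeasure (restrict_space M E) (ball x (dist x y) \<inter> space (restrict_space M E))
                \<le> emeasure M (ball x (dist x y))"
              using E by (auto simp: space_restrict_space emeasure_restrict_space sets_M
                intro!: emeasure_mono)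
            then have "inverse (ennreal (dist x y powr (\<theta> * p)) * emeasure M (ball x (dist x y)))
              \<le> inverse (ennreal (dist x y powr (\<theta> * p)) * emeasure (restrict_space M E)
                  (ball x (dist x y) \<inter> space (restrict_space M E)))"
              by (intro ennreal_inverse_antimono mult_left_mono) auto
            then show "kernel (\<theta> * p) (x, y) * ennreal (\<bar>G (x, y)\<bar> powr p) \<le>
              (if x = y then 0 else
              ennreal (\<bar>f y - f x\<bar> powr p) /
                (ennreal (dist x y powr (\<theta> * p)) * emeasure (restrict_space M E)
                  (ball x (dist x y) \<inter> space (restrict_space M E)))) * indicator E y"
              using True by (auto simp: kernel_def G_def g_def increment_def divide_ennreal_def
                  mult.commute indicator_def intro!: mult_left_mono)
          qed
        qed (use E in simp)
        then show ?thesis using True by simp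
      qed
    qed
  qed
  also have "\<dots> < \<infinity>" using f by (simp add: besov_def)
  finally show "(\<lambda>z. indicat_real (E \<times> E) z * increment (\<lambda>x. indicat_real E x * f x) z)
      \<in> Lp_fun (besov_measure (\<theta> * p)) p"
    using G unfolding G_def[abs_def] g_def[abs_def] by (simp add: Lp_fun_iff)
qed

lemma besov_restrict_if_constant:
  assumes f: "f \<in> borel_measurable M" and E: "E \<in> sets M" "emeasure M E < \<infinity>"
    and c: "AE x in M. x \<in> E \<longrightarrow> f x = c"
  shows "f \<in> besov (restrict_space M E) p \<theta>"
proof -
  have c': "AE x in restrict_space M E. f x = c"
    using c E by (subst AE_restrict_space_iff) auto
  have "(\<integral>\<^sup>+x. ennreal (\<bar>f x\<bar> powr p) \<partial>restrict_space M E)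
      = (\<integral>\<^sup>+x. ennreal (\<bar>c\<bar> powr p) \<partial>restrict_space M E)"
    by (rule nn_integral_cong_AE, use c' in eventually_elim) simp
  also have "\<dots> < \<infinity>"
    using E by (simp add: emeasure_restrict_space space_restrict_space ennreal_mult_less_top)
  finally have "f \<in> Lp_fun (restrict_space M E) p"
    using f by (simp add: Lp_fun_iff measurable_restrict_space1)
  moreover have "besov_energy (restrict_space M E) p \<theta> f = (\<integral>\<^sup>+x. 0 \<partial>restrict_space M E)"
    unfolding besov_energy_def
  proof (rule nn_integral_cong_AE, use c' in eventually_elim)
    case (elim x)
    have "(\<integral>\<^sup>+y. (if x = y then 0 else
        ennreal (\<bar>f y - f x\<bar> powr p) /
          (ennreal (dist x y powr (\<theta> * p)) * emeasure (restrict_space M E)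
            (ball x (dist x y) \<inter> space (restrict_space M E)))) \<partial>restrict_space M E)
      = (\<integral>\<^sup>+y. 0 \<partial>restrict_space M E)"
      by (rule nn_integral_cong_AE, use c' in eventually_elim) (use elim in simp)
    then show ?case by simp
  qed
  ultimately show ?thesis by (simp add: besov_def)
qed

text \<open>Truncation makes the interaction between \<open>E\<close> and its complement finite, as it is then
  controlled by the energy of the indicator of \<open>E\<close>.\<close>

lemma truncated_cut_off_besov:
  assumes f: "f \<in> besov (restrict_space M E) p \<theta>" and E: "E \<in> sets M"
    and ind: "indicat_real E \<in> besov M p \<theta>" and p: "0 \<le> p" and n: "0 \<le> n"
  shows "(\<lambda>x. max (- n) (min n (indicat_real E x * f x))) \<in> besov M p \<theta>"
proof -
  define g where "g x = indicat_real E x * f x" for x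
  define w where "w x = max (- n) (min n (g x))" for x
  note cut = besov_restrict_cut_off[OF f E, folded g_def]
  have [measurable]: "E \<in> sets M" "g \<in> borel_measurable M"
    using E cut by (auto simp: Lp_fun_iff)
  have w [measurable]: "w \<in> borel_measurable M" unfolding w_def[abs_def] by measurable
  have "w \<in> Lp_fun M p"
    by (rule Lp_fun_dominated[OF cut(1), where L = 1]) (use w p n in \<open>auto simp: w_def\<close>)
  moreover have "increment w \<in> Lp_fun (besov_measure (\<theta> * p)) p"
  proof (rule Lp_fun_dominated[where L = 1])
    show "(\<lambda>z. \<bar>indicat_real (E \<times> E) z * increment g z\<bar> + n * \<bar>increment (indicat_real E) z\<bar>)
        \<in> Lp_fun (besov_measure (\<theta> * p)) p"
    proof (rule Lp_fun_add)
      show "(\<lambda>z. \<bar>indicat_real (E \<times> E) z * increment g z\<bar>) \<in> Lp_fun (besov_measure (\<theta> * p)) p"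
        by (rule Lp_fun_dominated[OF cut(2), where L = 1]) (use p in auto)
      show "(\<lambda>z. n * \<bar>increment (indicat_real E) z\<bar>) \<in> Lp_fun (besov_measure (\<theta> * p)) p"
        by (rule Lp_fun_dominated[where f = "increment (indicat_real E)" and L = n])
          (use p n ind in \<open>auto simp: besov_iff abs_mult\<close>)
    qed (rule p)
    \<comment> \<open>Inside \<open>E\<close>, truncation does not enlarge increments of
      \<open>g\<close>. Across the boundary one value of \<open>w\<close> is 0 and the other is at
      most \<open>n\<close> in modulus, while the indicator has increment of modulus 1.\<close>
    have "\<bar>increment w (x, y)\<bar> \<le>
      \<bar>indicat_real (E \<times> E) (x, y) * increment g (x, y)\<bar> + n * \<bar>increment (indicat_real E) (x, y)\<bar>"
      for x y
      using n by (cases "x \<in> E"; cases "y \<in> E") (auto simp: increment_def w_def g_def)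
    then show "AE z in besov_measure (\<theta> * p). \<bar>increment w z\<bar> \<le>
      1 * \<bar>\<bar>indicat_real (E \<times> E) z * increment g z\<bar> + n * \<bar>increment (indicat_real E) z\<bar>\<bar>"
      using n by (intro AE_I2) (auto simp: split_paired_all)
  qed (use w p in \<open>auto simp: measurable_increment\<close>)
  ultimately show ?thesis unfolding w_def g_def by (simp add: besov_iff)
qed

section \<open>Monotonicity in the smoothness exponent\<close>

definition far :: "('a \<times> 'a) set" where
  "far = {z. 1 \<le> dist (fst z) (snd z)}"

lemma measurable_far [measurable]: "Measurable.pred (M \<Otimes>\<^sub>M M) (\<lambda>z. z \<in> far)"
  unfolding far_def mem_Collect_eq by measurable

text \<open>On the dyadic annulus between radii \<open>2 ^ n\<close> and \<open>2 * 2 ^ n\<close>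
  the kernel is at most \<open>a n\<close>. The annulus lies in a ball whose measure is, by
  doubling, at most \<open>C\<close> times the one in the denominator of \<open>a n\<close>, so a
  geometric series with ratio \<open>1 / 2 powr q\<close> remains.\<close>

lemma kernel_tail_le:
  assumes C: "\<And>x r. 0 < r \<Longrightarrow> emeasure M (ball x (2 * r)) \<le> ennreal C * emeasure M (ball x r)"
    and q: "0 < q"
  shows "(\<integral>\<^sup>+y. kernel q (x, y) * indicator far (x, y) \<partial>M)
    \<le> ennreal C * (\<Sum>n. ennreal ((1 / 2 powr q) ^ n))"
proof -
  define a where "a n = inverse (ennreal ((2 ^ n) powr q) * emeasure M (ball x (2 ^ n)))" for n :: nat
  have ball_sets [measurable]: "ball x r \<in> sets M" for r by (simp add: sets_M)
  have "kernel q (x, y) * indicator far (x, y) \<le> (\<Sum>n. indicator (ball x (2 * 2 ^ n)) y * a n)" for y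
  proof (cases "1 \<le> dist x y")
    case True
    define n where "n = nat \<lfloor>log 2 (dist x y)\<rfloor>"
    have "0 \<le> log 2 (dist x y)" using True by (subst zero_le_log_cancel_iff) auto
    then have n: "real n \<le> log 2 (dist x y)" "log 2 (dist x y) < real n + 1"
      unfolding n_def by (simp_all add: of_nat_nat)
    have "2 powr real n \<le> dist x y" "dist x y < 2 powr (real n + 1)"
      using n True by (auto simp: le_log_iff[OF _ less_le_trans[OF zero_less_one]]
        log_less_iff[OF _ less_le_trans[OF zero_less_one]])
    then have d: "2 ^ n \<le> dist x y" "dist x y < 2 * 2 ^ n"
      by (simp_all add: powr_realpow powr_add)
    have "kernel q (x, y) \<le> a n"
      using d True q unfolding kernel_def a_def
      by (auto intro!: ennreal_inverse_antimono mult_mono emeasure_mono powr_mono2 simp: sets_M)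
    also have "a n = (\<Sum>k\<in>{n}. indicator (ball x (2 * 2 ^ k)) y * a k)" using d by simp
    also have "\<dots> \<le> (\<Sum>k. indicator (ball x (2 * 2 ^ k)) y * a k)" by (rule sum_le_suminf) auto
    finally show ?thesis using True by (simp add: far_def)
  qed (simp add: far_def)
  then have "(\<integral>\<^sup>+y. kernel q (x, y) * indicator far (x, y) \<partial>M)
      \<le> (\<integral>\<^sup>+y. (\<Sum>n. indicator (ball x (2 * 2 ^ n)) y * a n) \<partial>M)"
    by (intro nn_integral_mono)
  also have "\<dots> = (\<Sum>n. \<integral>\<^sup>+y. indicator (ball x (2 * 2 ^ n)) y * a n \<partial>M)"
    by (rule nn_integral_suminf) measurable
  also have "\<dots> = (\<Sum>n. emeasure M (ball x (2 * 2 ^ n)) * a n)"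
    by (simp add: nn_integral_multc)
  also have "\<dots> \<le> (\<Sum>n. ennreal C * ennreal ((1 / 2 powr q) ^ n))"
  proof (rule suminf_le)
    fix n :: nat
    let ?b = "emeasure M (ball x (2 ^ n))"
    have b: "?b \<noteq> 0" "?b < top" using emeasure_ball_pos[of "2 ^ n" x] emeasure_ball_finite[of "2 ^ n" x] by auto
    have "emeasure M (ball x (2 * 2 ^ n)) * a n \<le> (ennreal C * ?b) * a n"
      using C[of "2 ^ n" x] by (intro mult_right_mono) auto
    also have "\<dots> = ennreal C * inverse (ennreal ((2 ^ n) powr q)) * (?b * inverse ?b)"
      using b by (simp add: a_def ennreal_inverse_mult mult_ac)
    also have "?b * inverse ?b = 1" using b by (simp flip: divide_ennreal_def)
    also have "inverse (ennreal ((2 ^ n) powr q)) = ennreal ((1 / 2 powr q) ^ n)"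
    proof -
      have "((2::real) ^ n) powr q = (2 powr q) ^ n"
        by (simp add: powr_powr mult.commute flip: powr_realpow)
      then show ?thesis by (simp add: inverse_ennreal field_simps)
    qed
    finally show "emeasure M (ball x (2 * 2 ^ n)) * a n \<le> ennreal C * ennreal ((1 / 2 powr q) ^ n)"
      by simp
  qed auto
  finally show ?thesis by simp
qed

text \<open>The kernel is not symmetric because its ball is centred at the first point. The ball
  around \<open>y\<close> lies in the ball of twice the radius around \<open>x\<close>, so
  exchanging the centres costs one doubling constant.\<close>

lemma kernel_swap_le:
  assumes C: "\<And>x r. 0 < r \<Longrightarrow> emeasure M (ball x (2 * r)) \<le> ennreal C * emeasure M (ball x r)"
  shows "kernel q (x, y) \<le> ennreal C * kernel q (y, x)"
proof (cases "x = y")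
  case False
  define d where "d = dist x y"
  have d: "0 < d" "dist y x = d" using False by (auto simp: d_def dist_commute)
  have "emeasure M (ball y d) \<le> emeasure M (ball x (2 * d))"
  proof (intro emeasure_mono subsetI)
    fix z assume "z \<in> ball y d"
    then show "z \<in> ball x (2 * d)" using dist_triangle[of x z y] by (auto simp: d_def)
  qed (simp add: sets_M)
  also have "\<dots> \<le> ennreal C * emeasure M (ball x d)" by (rule C[OF d(1)])
  finally have le: "emeasure M (ball y d) \<le> ennreal C * emeasure M (ball x d)" .
  let ?a = "emeasure M (ball x d)" and ?b = "emeasure M (ball y d)" and ?c = "inverse (ennreal (d powr q))"
  have a: "?a \<noteq> 0" "?a < top" and b: "?b \<noteq> 0" "?b < top"
    using emeasure_ball_pos[OF d(1)] emeasure_ball_finite[OF d(1)] by (auto simp: less_le)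
  have "inverse ?a = inverse ?a * (?b * inverse ?b)" using b by (simp flip: divide_ennreal_def)
  also have "\<dots> \<le> inverse ?a * ((ennreal C * ?a) * inverse ?b)"
    by (intro mult_left_mono mult_right_mono le) auto
  also have "\<dots> = ennreal C * inverse ?b * (?a * inverse ?a)" by (simp add: mult_ac)
  also have "?a * inverse ?a = 1" using a by (simp flip: divide_ennreal_def)
  finally have "?c * inverse ?a \<le> ?c * (ennreal C * inverse ?b)" by (intro mult_left_mono) auto
  then show ?thesis using a b d
    by (simp add: kernel_def d_def[symmetric] ennreal_inverse_mult mult_ac)
qed (simp add: kernel_def)

text \<open>At distances at least 1 the kernel is integrable in either variable, so only the behaviour of
  \<open>u\<close> at small distances matters, where a larger exponent gives a larger kernel.\<close>

lemma besov_antimono: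
  assumes C: "\<And>x r. 0 < r \<Longrightarrow> emeasure M (ball x (2 * r)) \<le> ennreal C * emeasure M (ball x r)"
    and p: "0 < p" and \<theta>: "0 < \<theta>" "\<theta> \<le> \<theta>'"
  shows "besov M p \<theta>' \<subseteq> besov M p \<theta>"
proof
  fix u assume u: "u \<in> besov M p \<theta>'"
  have [measurable]: "u \<in> borel_measurable M" using u by (rule besov_measurable)
  have uLp: "u \<in> Lp_fun M p" using u by (simp add: besov_iff)
  define q where "q = \<theta> * p"
  have q: "0 < q" using \<theta> p by (simp add: q_def)
  define K where "K = ennreal C * (\<Sum>n. ennreal ((1 / 2 powr q) ^ n))"
  have "1 < 2 powr q" using q by simp
  then have "(\<Sum>n. ennreal ((1 / 2 powr q) ^ n)) < top"
    unfolding less_top[symmetric] by (intro ennreal_suminf_neq_top summable_geometric) auto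
  then have K: "K < top" by (simp add: K_def ennreal_mult_less_top)
  have tail: "(\<integral>\<^sup>+y. kernel q (x, y) * indicator far (x, y) \<partial>M) \<le> K" for x
    unfolding K_def by (rule kernel_tail_le[OF C q])
  define U where "U = (\<integral>\<^sup>+x. ennreal (\<bar>u x\<bar> powr p) \<partial>M)"
  have U: "U < top" using uLp by (simp add: U_def Lp_fun_iff)
  have bound: "(\<integral>\<^sup>+x. \<integral>\<^sup>+y. kernel q (x, y) * indicator far (x, y) * ennreal (\<bar>u x\<bar> powr p) \<partial>M \<partial>M) \<le> K * U"
  proof -
    have "(\<integral>\<^sup>+x. \<integral>\<^sup>+y. kernel q (x, y) * indicator far (x, y) * ennreal (\<bar>u x\<bar> powr p) \<partial>M \<partial>M)
      = (\<integral>\<^sup>+x. (\<integral>\<^sup>+y. kernel q (x, y) * indicator far (x, y) \<partial>M) * ennreal (\<bar>u x\<bar> powr p) \<partial>M)"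
      by (intro nn_integral_cong nn_integral_multc) measurable
    also have "\<dots> \<le> (\<integral>\<^sup>+x. K * ennreal (\<bar>u x\<bar> powr p) \<partial>M)"
      by (intro nn_integral_mono mult_right_mono tail) auto
    also have "\<dots> = K * U" unfolding U_def by (rule nn_integral_cmult) measurable
    finally show ?thesis .
  qed
  \<comment> \<open>Under the measure restricted to far pairs, \<open>u (fst z)\<close> and
    \<open>u (snd z)\<close> are separately in L^p, and so is their difference.\<close>
  define N where "N = density (besov_measure q) (indicator far)"
  have N [simp]: "measurable N L = measurable (M \<Otimes>\<^sub>M M) L" for L :: "real measure"
    by (rule measurable_cong_sets) (simp_all add: N_def besov_measure_def)
  have intN: "(\<integral>\<^sup>+z. h z \<partial>N) = (\<integral>\<^sup>+x. \<integral>\<^sup>+y. kernel q (x, y) * indicator far (x, y) * h (x, y) \<partial>M \<partial>M)"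
    if [measurable]: "h \<in> borel_measurable (M \<Otimes>\<^sub>M M)" for h
  proof -
    have "(\<integral>\<^sup>+z. h z \<partial>N) = (\<integral>\<^sup>+z. indicator far z * h z \<partial>besov_measure q)"
      unfolding N_def by (rule nn_integral_density) (simp_all, measurable)
    also have "\<dots> = (\<integral>\<^sup>+x. \<integral>\<^sup>+y. kernel q (x, y) * (indicator far (x, y) * h (x, y)) \<partial>M \<partial>M)"
      by (rule nn_integral_besov_measure) measurable
    finally show ?thesis by (simp add: mult.assoc)
  qed
  have "(\<lambda>z. u (fst z)) \<in> Lp_fun N p"
  proof -
    have "(\<integral>\<^sup>+z. ennreal (\<bar>u (fst z)\<bar> powr p) \<partial>N) \<le> K * U"
      using bound by (subst intN) simp_all
    also have "\<dots> < top" using K U by (simp add: ennreal_mult_less_top)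
    finally show ?thesis by (simp add: Lp_fun_iff)
  qed
  then have 1: "(\<lambda>z. - 1 * u (fst z)) \<in> Lp_fun N p" by (rule Lp_fun_cmult) (use p in simp)
  \<comment> \<open>The tail bound integrates out the second variable, but \<open>u\<close> now
    depends on it. Swapping the kernel and applying Tonelli returns to the previous case at the cost
    of \<open>C\<close>.\<close>
  have 2: "(\<lambda>z. u (snd z)) \<in> Lp_fun N p"
  proof -
    have "(\<integral>\<^sup>+z. ennreal (\<bar>u (snd z)\<bar> powr p) \<partial>N)
        = (\<integral>\<^sup>+x. \<integral>\<^sup>+y. kernel q (x, y) * indicator far (x, y) * ennreal (\<bar>u y\<bar> powr p) \<partial>M \<partial>M)"
      by (subst intN) simp_all
    also have "\<dots> \<le> (\<integral>\<^sup>+x. \<integral>\<^sup>+y. ennreal C * (kernel q (y, x) * indicator far (y, x) * ennreal (\<bar>u y\<bar> powr p)) \<partial>M \<partial>M)"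
    proof (intro nn_integral_mono)
      fix x y
      have "kernel q (x, y) * indicator far (x, y) \<le> (ennreal C * kernel q (y, x)) * indicator far (y, x)"
        by (intro mult_mono kernel_swap_le[OF C]) (auto simp: far_def dist_commute indicator_def)
      from mult_right_mono[OF this, of "ennreal (\<bar>u y\<bar> powr p)"]
      show "kernel q (x, y) * indicator far (x, y) * ennreal (\<bar>u y\<bar> powr p)
          \<le> ennreal C * (kernel q (y, x) * indicator far (y, x) * ennreal (\<bar>u y\<bar> powr p))"
        by (simp add: mult_ac)
    qed
    also have "\<dots> = (\<integral>\<^sup>+y. \<integral>\<^sup>+x. ennreal C * (kernel q (y, x) * indicator far (y, x) * ennreal (\<bar>u y\<bar> powr p)) \<partial>M \<partial>M)"
      by (rule pair.Fubini'[symmetric]) measurable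
    also have "\<dots> = ennreal C * (\<integral>\<^sup>+y. \<integral>\<^sup>+x. kernel q (y, x) * indicator far (y, x) * ennreal (\<bar>u y\<bar> powr p) \<partial>M \<partial>M)"
      by (subst nn_integral_cmult[symmetric], measurable, intro nn_integral_cong nn_integral_cmult) measurable
    also have "\<dots> \<le> ennreal C * (K * U)" by (intro mult_left_mono bound) simp
    also have "\<dots> < top" using K U by (simp add: ennreal_mult_less_top)
    finally show ?thesis by (simp add: Lp_fun_iff)
  qed
  have "increment u \<in> Lp_fun N p"
    using Lp_fun_add[OF 1 2] p by (simp add: increment_def[abs_def])
  then have far_fin: "(\<integral>\<^sup>+x. \<integral>\<^sup>+y. kernel q (x, y) * indicator far (x, y) * ennreal (\<bar>increment u (x, y)\<bar> powr p) \<partial>M \<partial>M) < top"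
    by (simp add: Lp_fun_iff intN)
  have near_fin: "(\<integral>\<^sup>+x. \<integral>\<^sup>+y. kernel (\<theta>' * p) (x, y) * ennreal (\<bar>increment u (x, y)\<bar> powr p) \<partial>M \<partial>M) < top"
    using u by (simp add: besov_iff Lp_fun_iff nn_integral_besov_measure)
  have le: "kernel q z \<le> kernel (\<theta>' * p) z + kernel q z * indicator far z" for z
  proof (cases "z \<in> far")
    case False
    let ?d = "dist (fst z) (snd z)"
    \<comment> \<open>For distances below 1 powers decrease in the exponent, hence the kernels
      increase.\<close>
    have "?d powr (\<theta>' * p) \<le> ?d powr q" if "?d \<noteq> 0"
      using False that \<theta> p by (intro powr_mono') (auto simp: far_def q_def)
    then have "kernel q z \<le> kernel (\<theta>' * p) z"
      by (auto simp: kernel_def intro!: ennreal_inverse_antimono mult_right_mono)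
    then show ?thesis by (simp add: add_increasing2)
  qed simp
  have "(\<integral>\<^sup>+x. \<integral>\<^sup>+y. kernel q (x, y) * ennreal (\<bar>increment u (x, y)\<bar> powr p) \<partial>M \<partial>M)
      \<le> (\<integral>\<^sup>+x. \<integral>\<^sup>+y. kernel (\<theta>' * p) (x, y) * ennreal (\<bar>increment u (x, y)\<bar> powr p) +
        kernel q (x, y) * indicator far (x, y) * ennreal (\<bar>increment u (x, y)\<bar> powr p) \<partial>M \<partial>M)"
    by (intro nn_integral_mono) (use mult_right_mono[OF le] in \<open>simp add: distrib_right[symmetric]\<close>)
  also have "\<dots> = (\<integral>\<^sup>+x. (\<integral>\<^sup>+y. kernel (\<theta>' * p) (x, y) * ennreal (\<bar>increment u (x, y)\<bar> powr p) \<partial>M) +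
      (\<integral>\<^sup>+y. kernel q (x, y) * indicator far (x, y) * ennreal (\<bar>increment u (x, y)\<bar> powr p) \<partial>M) \<partial>M)"
    by (intro nn_integral_cong nn_integral_add) measurable
  also have "\<dots> = (\<integral>\<^sup>+x. \<integral>\<^sup>+y. kernel (\<theta>' * p) (x, y) * ennreal (\<bar>increment u (x, y)\<bar> powr p) \<partial>M \<partial>M) +
      (\<integral>\<^sup>+x. \<integral>\<^sup>+y. kernel q (x, y) * indicator far (x, y) * ennreal (\<bar>increment u (x, y)\<bar> powr p) \<partial>M \<partial>M)"
    by (rule nn_integral_add) measurable
  also have "\<dots> < top" using far_fin near_fin by simp
  finally show "u \<in> besov M p \<theta>"
    using uLp by (simp add: besov_iff Lp_fun_iff nn_integral_besov_measure q_def)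
qed

section \<open>Korevaar-Schoen energies\<close>

text \<open>The average at scale \<open>t\<close> is written as an integral over the product, like
  the Besov energy, so that both seminorms integrate the same power of \<open>increment\<close> and
  only densities have to be compared.\<close>

definition ks_measure :: "real \<Rightarrow> real \<Rightarrow> ('a \<times> 'a) measure" where
  "ks_measure q t = density (M \<Otimes>\<^sub>M M) (\<lambda>z. if dist (fst z) (snd z) < t
     then inverse (ennreal (t powr q) * emeasure M (ball (fst z) t)) else 0)"

lemma measurable_ks_measure [simp]: "measurable (ks_measure q t) N = measurable (M \<Otimes>\<^sub>M M) N"
  by (rule measurable_cong_sets) (simp_all add: ks_measure_def)

lemma nn_integral_ks_measure:
  assumes [measurable]: "h \<in> borel_measurable (M \<Otimes>\<^sub>M M)"
  shows "(\<integral>\<^sup>+z. h z \<partial>ks_measure q t) = (\<integral>\<^sup>+x. \<integral>\<^sup>+y. (if dist x y < t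
     then inverse (ennreal (t powr q) * emeasure M (ball x t)) else 0) * h (x, y) \<partial>M \<partial>M)"
proof -
  have "(\<integral>\<^sup>+z. h z \<partial>ks_measure q t) = (\<integral>\<^sup>+z. (if dist (fst z) (snd z) < t
     then inverse (ennreal (t powr q) * emeasure M (ball (fst z) t)) else 0) * h z \<partial>(M \<Otimes>\<^sub>M M))"
    unfolding ks_measure_def by (rule nn_integral_density) measurable
  also have "\<dots> = (\<integral>\<^sup>+x. \<integral>\<^sup>+y. (if dist (fst (x, y)) (snd (x, y)) < t
     then inverse (ennreal (t powr q) * emeasure M (ball (fst (x, y)) t)) else 0) * h (x, y) \<partial>M \<partial>M)"
    by (rule nn_integral_fst[symmetric]) measurable
  finally show ?thesis by (simp only: fst_conv snd_conv)
qed

lemma ks_energy_eq: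
  assumes [measurable]: "u \<in> borel_measurable M"
  shows "ks_energy M p \<theta> u = Limsup (at_right 0) (\<lambda>t. \<integral>\<^sup>+z. ennreal (\<bar>increment u z\<bar> powr p) \<partial>ks_measure (\<theta> * p) t)"
  unfolding ks_energy_def
proof (intro Limsup_eq eventually_at_right_less[THEN eventually_mono])
  fix t :: real assume t: "0 < t"
  have [measurable]: "ball x t \<in> sets M" for x by (simp add: sets_M)
  show "(\<integral>\<^sup>+x. 1 / emeasure M (ball x t \<inter> space M) *
         (\<integral>\<^sup>+y\<in>ball x t \<inter> space M. ennreal (\<bar>u y - u x\<bar> powr p / t powr (\<theta> * p)) \<partial>M) \<partial>M)
    = (\<integral>\<^sup>+z. ennreal (\<bar>increment u z\<bar> powr p) \<partial>ks_measure (\<theta> * p) t)"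
  proof (subst nn_integral_ks_measure, measurable, intro nn_integral_cong)
    fix x
    \<comment> \<open>Finiteness lets the inverse of the product in the density be split into its
      factors.\<close>
    have fin: "emeasure M (ball x t) < top" using emeasure_ball_finite[OF t] by simp
    have "1 / emeasure M (ball x t \<inter> space M) *
         (\<integral>\<^sup>+y\<in>ball x t \<inter> space M. ennreal (\<bar>u y - u x\<bar> powr p / t powr (\<theta> * p)) \<partial>M)
      = (\<integral>\<^sup>+y. inverse (emeasure M (ball x t)) *
         (ennreal (\<bar>u y - u x\<bar> powr p / t powr (\<theta> * p)) * indicator (ball x t) y) \<partial>M)"
      by (subst nn_integral_cmult) (simp_all add: divide_ennreal_def)
    also have "\<dots> = (\<integral>\<^sup>+y. (if dist x y < t
       then inverse (ennreal (t powr (\<theta> * p)) * emeasure M (ball x t)) else 0) *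
       ennreal (\<bar>increment u (x, y)\<bar> powr p) \<partial>M)"
      using t fin by (intro nn_integral_cong)
        (auto simp: ennreal_inverse_mult increment_def indicator_def mult_ac divide_ennreal_def
          simp flip: divide_ennreal)
    finally show "1 / emeasure M (ball x t \<inter> space M) *
         (\<integral>\<^sup>+y\<in>ball x t \<inter> space M. ennreal (\<bar>u y - u x\<bar> powr p / t powr (\<theta> * p)) \<partial>M)
      = (\<integral>\<^sup>+y. (if dist x y < t
       then inverse (ennreal (t powr (\<theta> * p)) * emeasure M (ball x t)) else 0) *
       ennreal (\<bar>increment u (x, y)\<bar> powr p) \<partial>M)" .
  qed
qed

text \<open>For \<open>dist x y < t\<close> both factors in the denominator of the kernel grow when
  the distance is replaced by \<open>t\<close>, so the averaging density lies below the kernel. The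
  energy near the diagonal vanishes in the limit by dominated convergence, as the kernel is 0 on the
  diagonal itself.\<close>

lemma ks_integral_tendsto_0:
  assumes u: "u \<in> besov M p \<theta>" and q: "0 \<le> \<theta> * p" and p: "0 < p"
  shows "((\<lambda>t. \<integral>\<^sup>+z. ennreal (\<bar>increment u z\<bar> powr p) \<partial>ks_measure (\<theta> * p) t) \<longlongrightarrow> 0) (at_right 0)"
proof -
  have [measurable]: "u \<in> borel_measurable M" using u by (rule besov_measurable)
  define G where "G z = kernel (\<theta> * p) z * ennreal (\<bar>increment u z\<bar> powr p)" for z
  have G [measurable]: "G \<in> borel_measurable (M \<Otimes>\<^sub>M M)" unfolding G_def[abs_def] by measurable
  \<comment> \<open>Dominated convergence is used along the radii \<open>1 / real (Suc n)\<close>;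
    every smaller radius is then compared with one of them.\<close>
  define D where "D n z = (if dist (fst z) (snd z) < 1 / real (Suc n) then G z else 0)" for n z
  have D [measurable]: "D n \<in> borel_measurable (M \<Otimes>\<^sub>M M)" for n unfolding D_def[abs_def] by measurable
  have "(\<lambda>n. \<integral>\<^sup>+z. D n z \<partial>(M \<Otimes>\<^sub>M M)) \<longlonglongrightarrow> (\<integral>\<^sup>+z. 0 \<partial>(M \<Otimes>\<^sub>M M))"
  proof (rule nn_integral_dominated_convergence[where w = G])
    show "(\<integral>\<^sup>+z. G z \<partial>(M \<Otimes>\<^sub>M M)) < \<infinity>"
      using u unfolding G_def
      by (simp add: besov_iff Lp_fun_iff besov_measure_def nn_integral_density)
    show "AE z in M \<Otimes>\<^sub>M M. (\<lambda>n. D n z) \<longlonglongrightarrow> 0"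
    proof (rule AE_I2)
      fix z :: "'a \<times> 'a"
      show "(\<lambda>n. D n z) \<longlonglongrightarrow> 0"
      proof (cases "dist (fst z) (snd z) = 0")
        case True
        then show ?thesis by (simp add: D_def G_def kernel_def)
      next
        case False
        then obtain n where n: "1 / real (Suc n) < dist (fst z) (snd z)"
          using nat_approx_posE[of "dist (fst z) (snd z)"] by (metis zero_less_dist_iff dist_eq_0_iff)
        have "D k z = 0" if "n \<le> k" for k
        proof -
          have "1 / real (Suc k) \<le> 1 / real (Suc n)" using that by (intro divide_left_mono) auto
          then show ?thesis using n by (simp add: D_def)
        qed
        then show ?thesis by (intro tendsto_eventually) (auto simp: eventually_sequentially)
      qed
    qed
  qed (auto simp: D_def)
  then have lim: "(\<lambda>n. \<integral>\<^sup>+z. D n z \<partial>(M \<Otimes>\<^sub>M M)) \<longlonglongrightarrow> 0" by simp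
  have le: "(\<integral>\<^sup>+z. ennreal (\<bar>increment u z\<bar> powr p) \<partial>ks_measure (\<theta> * p) t) \<le> (\<integral>\<^sup>+z. D n z \<partial>(M \<Otimes>\<^sub>M M))"
    if t: "0 < t" "t < 1 / real (Suc n)" for t n
  proof -
    have "(\<integral>\<^sup>+z. ennreal (\<bar>increment u z\<bar> powr p) \<partial>ks_measure (\<theta> * p) t)
      = (\<integral>\<^sup>+z. (if dist (fst z) (snd z) < t
     then inverse (ennreal (t powr (\<theta> * p)) * emeasure M (ball (fst z) t)) else 0) *
       ennreal (\<bar>increment u z\<bar> powr p) \<partial>(M \<Otimes>\<^sub>M M))"
      unfolding ks_measure_def by (rule nn_integral_density) measurable
    also have "\<dots> \<le> (\<integral>\<^sup>+z. D n z \<partial>(M \<Otimes>\<^sub>M M))"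
    proof (rule nn_integral_mono)
      fix z :: "'a \<times> 'a"
      let ?d = "dist (fst z) (snd z)"
      have "inverse (ennreal (t powr (\<theta> * p)) * emeasure M (ball (fst z) t)) \<le> kernel (\<theta> * p) z"
        if "?d < t" "?d \<noteq> 0"
        using that q unfolding kernel_def
        by (auto intro!: ennreal_inverse_antimono mult_mono emeasure_mono powr_mono2 simp: sets_M)
      \<comment> \<open>On the diagonal the kernel is 0 but the averaging density is positive, so
        the comparison there rests on the vanishing increment.\<close>
      moreover have "increment u z = 0" if "?d = 0" using that by (simp add: increment_def)
      ultimately show "(if ?d < t
     then inverse (ennreal (t powr (\<theta> * p)) * emeasure M (ball (fst z) t)) else 0) *
       ennreal (\<bar>increment u z\<bar> powr p) \<le> D n z"
        using t p unfolding D_def G_def by (cases "?d = 0") (auto intro!: mult_right_mono)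
    qed
    finally show ?thesis .
  qed
  show ?thesis
  proof (rule order_tendstoI)
    fix a :: ennreal assume "0 < a"
    then have "\<forall>\<^sub>F n in sequentially. (\<integral>\<^sup>+z. D n z \<partial>(M \<Otimes>\<^sub>M M)) < a" using lim by (intro order_tendstoD)
    then obtain n where n: "(\<integral>\<^sup>+z. D n z \<partial>(M \<Otimes>\<^sub>M M)) < a" by (auto simp: eventually_sequentially)
    have "\<forall>\<^sub>F t in at_right 0. t \<in> {0<..<1 / real (Suc n)}"
      by (rule eventually_at_right_real) simp
    then show "\<forall>\<^sub>F t in at_right 0. (\<integral>\<^sup>+z. ennreal (\<bar>increment u z\<bar> powr p) \<partial>ks_measure (\<theta> * p) t) < a"
      by eventually_elim (use le n in \<open>auto intro: le_less_trans\<close>)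
  qed simp
qed

lemma ks_energy_besov:
  assumes "u \<in> besov M p \<theta>" "0 \<le> \<theta> * p" "0 < p"
  shows "ks_energy M p \<theta> u = 0"
  using ks_integral_tendsto_0[OF assms] besov_measurable[OF assms(1)]
  by (simp add: ks_energy_eq lim_imp_Limsup)

text \<open>For a pair with exactly one point in \<open>E\<close>, the increment of the cut-off is
  at most \<open>B\<close> times that of the indicator. These pairs contribute at most
  \<open>R t\<close>, which tends to 0; pairs inside \<open>E\<close> contribute exactly
  \<open>A t\<close>.\<close>

lemma ks_energy_cut_off:
  assumes u [measurable]: "u \<in> borel_measurable M" and bd: "AE x in M. \<bar>u x\<bar> \<le> B"
    and E [measurable]: "E \<in> sets M" and ind: "indicat_real E \<in> besov M p \<theta>"
    and q: "0 \<le> \<theta> * p" and p: "0 < p"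
  shows "ks_energy M p \<theta> (\<lambda>x. u x * indicat_real E x) =
    Limsup (at_right 0) (\<lambda>r::real. \<integral>\<^sup>+x\<in>E. (\<integral>\<^sup>+y\<in>ball x r \<inter> E.
      ennreal (\<bar>u y - u x\<bar> powr p) / (ennreal (r powr (\<theta> * p)) * emeasure M (ball x r)) \<partial>M) \<partial>M)"
proof -
  define A where "A t = (\<integral>\<^sup>+z. indicator (E \<times> E) z * ennreal (\<bar>increment u z\<bar> powr p) \<partial>ks_measure (\<theta> * p) t)" for t
  define w where "w x = u x * indicat_real E x" for x
  have [measurable]: "w \<in> borel_measurable M" unfolding w_def[abs_def] by measurable
  define R where "R t = ennreal (\<bar>B\<bar> powr p) *
    (\<integral>\<^sup>+z. ennreal (\<bar>increment (indicat_real E) z\<bar> powr p) \<partial>ks_measure (\<theta> * p) t)" for t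
  have "(R \<longlongrightarrow> ennreal (\<bar>B\<bar> powr p) * 0) (at_right 0)"
    unfolding R_def by (intro ennreal_tendsto_cmult ks_integral_tendsto_0[OF ind q p]) simp
  then have R: "(R \<longlongrightarrow> 0) (at_right 0)" by simp
  have eqA: "(\<integral>\<^sup>+x\<in>E. (\<integral>\<^sup>+y\<in>ball x r \<inter> E.
      ennreal (\<bar>u y - u x\<bar> powr p) / (ennreal (r powr (\<theta> * p)) * emeasure M (ball x r)) \<partial>M) \<partial>M) = A r" for r
    unfolding A_def
    by (subst nn_integral_ks_measure, measurable, intro nn_integral_cong)
      (auto simp: indicator_def increment_def divide_ennreal_def mult.commute intro!: nn_integral_cong)
  have "AE z in M \<Otimes>\<^sub>M M. \<bar>u (fst z)\<bar> \<le> B \<and> \<bar>u (snd z)\<bar> \<le> B"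
    using bd by (intro AE_pair_fst_snd) measurable
  \<comment> \<open>The averaging measure has a density with respect to the product measure, so the
    essential bound carries over to pairs.\<close>
  then have bdks: "AE z in ks_measure (\<theta> * p) t. \<bar>u (fst z)\<bar> \<le> B \<and> \<bar>u (snd z)\<bar> \<le> B" for t
    unfolding ks_measure_def by (subst AE_density) (measurable, elim eventually_mono, simp)
  have upper: "(\<integral>\<^sup>+z. ennreal (\<bar>increment w z\<bar> powr p) \<partial>ks_measure (\<theta> * p) t) \<le> A t + R t" for t
  proof -
    have "(\<integral>\<^sup>+z. ennreal (\<bar>increment w z\<bar> powr p) \<partial>ks_measure (\<theta> * p) t)
      \<le> (\<integral>\<^sup>+z. indicator (E \<times> E) z * ennreal (\<bar>increment u z\<bar> powr p) +
        ennreal (\<bar>B\<bar> powr p) * ennreal (\<bar>increment (indicat_real E) z\<bar> powr p) \<partial>ks_measure (\<theta> * p) t)"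
    proof (rule nn_integral_mono_AE, use bdks[of t] in eventually_elim)
      case (elim z)
      obtain x y where z: "z = (x, y)" by (cases z)
      have "\<bar>u x\<bar> powr p \<le> \<bar>B\<bar> powr p" "\<bar>u y\<bar> powr p \<le> \<bar>B\<bar> powr p"
        using elim p z by (auto intro!: powr_mono2)
      then show ?case using p
        by (cases "x \<in> E"; cases "y \<in> E") (auto simp: z increment_def w_def ennreal_leI)
    qed
    also have "\<dots> = A t + R t"
      unfolding A_def R_def
      by (subst nn_integral_add) (simp_all add: nn_integral_cmult)
    finally show ?thesis .
  qed
  have lower: "A t \<le> (\<integral>\<^sup>+z. ennreal (\<bar>increment w z\<bar> powr p) \<partial>ks_measure (\<theta> * p) t)" for t
    unfolding A_def by (rule nn_integral_mono) (auto simp: indicator_def increment_def w_def)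
  have "ks_energy M p \<theta> w = Limsup (at_right 0) A"
    unfolding ks_energy_eq[OF \<open>w \<in> borel_measurable M\<close>]
    by (intro antisym Limsup_add_tendsto_0_le[OF _ R] Limsup_mono always_eventually allI upper lower)
  then show ?thesis unfolding w_def eqA .
qed

section \<open>Constancy on atoms and the critical exponent\<close>

lemma const_besov:
  assumes "emeasure M UNIV < \<infinity>"
  shows "(\<lambda>x. c) \<in> besov M p \<theta>"
  using assms by (simp add: besov_iff Lp_fun_iff increment_def[abs_def] ennreal_mult_less_top)

text \<open>The extension of \<open>f\<close> by zero need not be a Besov function, but its
  truncations are, and each of them is constant on \<open>E\<close>. Countably many exceptional null
  sets are removed at once.\<close>

lemma besov_restrict_ae_constant:
  assumes f: "f \<in> besov (restrict_space M E) p \<theta>" and E: "E \<in> sets M"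
    and ind: "indicat_real E \<in> besov M p \<theta>" and p: "0 \<le> p"
    and pos: "\<not> (AE x in M. x \<notin> E)"
    and const: "\<And>w. w \<in> besov M p \<theta> \<Longrightarrow> \<exists>c. AE x in M. x \<in> E \<longrightarrow> w x = c"
  shows "\<exists>c. AE x in M. x \<in> E \<longrightarrow> f x = c"
proof -
  define w where "w n x = max (- real n) (min (real n) (indicat_real E x * f x))" for n x
  have "\<exists>c. AE x in M. x \<in> E \<longrightarrow> w n x = c" for n
    unfolding w_def by (intro const truncated_cut_off_besov[OF f E ind p]) simp
  then obtain c where "\<And>n. AE x in M. x \<in> E \<longrightarrow> w n x = c n" by metis
  then have c: "AE x in M. \<forall>n. x \<in> E \<longrightarrow> w n x = c n" unfolding AE_all_countable by blast
  \<comment> \<open>Since \<open>E\<close> is not null, some point of it avoids all exceptional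
    sets; it serves as reference point.\<close>
  have "\<exists>x0\<in>E. \<forall>n. w n x0 = c n"
  proof (rule ccontr)
    assume *: "\<not> ?thesis"
    have "AE x in M. x \<notin> E" using c by eventually_elim (use * in blast)
    with pos show False by blast
  qed
  then obtain x0 where x0: "x0 \<in> E" "\<And>n. w n x0 = c n" by blast
  have "AE x in M. x \<in> E \<longrightarrow> f x = f x0" using c
  proof eventually_elim
    case (elim x)
    show ?case
    proof
      assume x: "x \<in> E"
      \<comment> \<open>At this truncation level neither value is altered, so equal truncations mean
        equal values.\<close>
      obtain n where n: "\<bar>f x\<bar> + \<bar>f x0\<bar> < real n" using reals_Archimedean2 by blast
      have "w n x = w n x0" using elim x x0 by simp
      then show "f x = f x0" using n x x0(1) by (simp add: w_def)
    qed
  qed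
  then show ?thesis by blast
qed

text \<open>A nonconstant function at an exponent above \<open>\<theta>\<close> would, by
  monotonicity of the spaces, be a nonconstant function at \<open>\<theta>\<close>.\<close>

lemma critical_exponent_le:
  assumes C: "\<And>x r. 0 < r \<Longrightarrow> emeasure M (ball x (2 * r)) \<le> ennreal C * emeasure M (ball x r)"
    and p: "0 < p" and \<theta>: "0 < \<theta>"
    and const: "\<And>u. u \<in> besov M p \<theta> \<Longrightarrow> ae_constant M u"
  shows "critical_exponent M p \<le> ennreal \<theta>"
  unfolding critical_exponent_def
proof (rule Sup_least, safe)
  fix \<theta>' u assume u: "u \<in> besov M p \<theta>'" "\<not> ae_constant M u"
  show "ennreal \<theta>' \<le> ennreal \<theta>"
  proof (rule ccontr)
    assume "\<not> ennreal \<theta>' \<le> ennreal \<theta>"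
    then have "\<theta> \<le> \<theta>'" using ennreal_leI linear by blast
    then show False using besov_antimono[OF C p \<theta>] const u by blast
  qed
qed

end

section \<open>The dichotomy and the properties of the atoms\<close>

theorem theorem1p1:
  fixes M :: "'a::{metric_space, second_countable_topology} measure"
    and p \<theta> :: real and k :: nat
  assumes infinite_space: "infinite (UNIV :: 'a set)"
    and borel: "sets M = sets borel"
    and balls: "\<And>x r. 0 < r \<Longrightarrow> 0 < emeasure M (ball x r) \<and> emeasure M (ball x r) < \<infinity>"
    and doubling: "doubling M"
    and p: "1 < p"
    and \<theta>: "0 < \<theta>"
    and dim: "has_ae_dim M (besov M p \<theta>) k"
  shows
    "(emeasure M UNIV = \<infinity> \<and>
      besov M p \<theta> = {u \<in> borel_measurable M. AE x in M. u x = 0} \<and>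
      critical_exponent M p \<le> ennreal \<theta>)
     \<or>
     (1 \<le> k \<and>
      (\<exists>E :: nat \<Rightarrow> 'a set.
        (\<forall>i<k. E i \<in> sets M) \<and>
        \<comment> \<open>(1)\<close>
        (\<forall>i<k. 0 < emeasure M (E i) \<and> emeasure M (E i) < \<infinity>) \<and>
        \<comment> \<open>(2)\<close>
        (emeasure M UNIV < \<infinity> \<longrightarrow> emeasure M (UNIV - (\<Union>i<k. E i)) = 0) \<and>
        \<comment> \<open>(3)\<close>
        (\<forall>i<k. indicat_real (E i) \<in> besov M p \<theta>) \<and>
        ae_basis M (besov M p \<theta>) k (\<lambda>i. indicat_real (E i)) \<and>
        \<comment> \<open>(4)\<close>
        besov M p \<theta> = besov_direct_sum M p \<theta> k E \<and>
        (emeasure M UNIV < \<infinity> \<longrightarrow> besov M p \<theta> = besov_pieces M p \<theta> k E) \<and>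
        (\<forall>i<k. has_ae_dim (restrict_space M (E i)) (besov (restrict_space M (E i)) p \<theta>) 1) \<and>
        \<comment> \<open>(5)\<close>
        (\<forall>i<k. ks_energy M p \<theta> (indicat_real (E i)) = 0) \<and>
        \<comment> \<open>(6)\<close>
        (\<forall>u \<in> ks_space M p \<theta> \<inter> Linfty_fun M. \<forall>j<k.
          ks_energy M p \<theta> (\<lambda>x. u x * indicat_real (E j) x) =
          Limsup (at_right 0) (\<lambda>r::real.
            \<integral>\<^sup>+x\<in>E j. (\<integral>\<^sup>+y\<in>ball x r \<inter> E j.
              ennreal (\<bar>u y - u x\<bar> powr p) /
                (ennreal (r powr (\<theta> * p)) * emeasure M (ball x r)) \<partial>M) \<partial>M)) \<and>
        \<comment> \<open>(7)\<close>
        (1 < k \<or> emeasure M UNIV = \<infinity> \<and> k = 1 \<longrightarrow> ennreal \<theta> \<le> critical_exponent M p) \<and>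
        (emeasure M UNIV < \<infinity> \<and> k = 1 \<longrightarrow> critical_exponent M p \<le> ennreal \<theta>)))"
proof -
  interpret metric_measure_space M
    by standard (use borel balls in auto)
  obtain C where C: "\<And>x r. 0 < r \<Longrightarrow> emeasure M (ball x (2 * r)) \<le> ennreal C * emeasure M (ball x r)"
    using doubling unfolding doubling_def by auto
  have p0: "0 \<le> p" "0 < p" and q0: "0 \<le> \<theta> * p" using p \<theta> by auto
  interpret V: lipschitz_stable_space M "besov M p \<theta>" by (rule lipschitz_stable_besov[OF p0(1)])
  obtain E :: "nat \<Rightarrow> 'a set" where disj: "disjoint_family_on E {..<k}"
    and ind: "\<And>i. i < k \<Longrightarrow> indicat_real (E i) \<in> besov M p \<theta>"
    and nonnull: "\<And>i. i < k \<Longrightarrow> \<not> (AE x in M. x \<notin> E i)"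
    and const: "\<And>f i. f \<in> besov M p \<theta> \<Longrightarrow> i < k \<Longrightarrow> \<exists>c. AE x in M. x \<in> E i \<longrightarrow> f x = c"
    and zero: "\<And>f. f \<in> besov M p \<theta> \<Longrightarrow> AE x in M. x \<notin> (\<Union>i<k. E i) \<longrightarrow> f x = 0"
    and basis: "ae_basis M (besov M p \<theta>) k (\<lambda>i. indicat_real (E i))"
    using V.atoms_of_finite_dimensional[OF dim] by blast
  have sets: "E i \<in> sets M" if "i < k" for i
    using besov_measurable[OF ind[OF that]] by (simp add: borel_measurable_indicator_iff)
  have fin: "emeasure M (E i) < \<infinity>" if "i < k" for i
  proof -
    \<comment> \<open>An indicator is its own \<open>p\<close>-th power, so membership in L^p bounds
      the measure of the atom.\<close>
    have "(\<integral>\<^sup>+x. ennreal (\<bar>indicat_real (E i) x\<bar> powr p) \<partial>M) = (\<integral>\<^sup>+x. indicator (E i) x \<partial>M)"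
      by (intro nn_integral_cong) (use p in \<open>simp add: indicator_def\<close>)
    then show ?thesis using ind[OF that] sets[OF that] by (simp add: besov_iff Lp_fun_iff)
  qed
  have pos: "0 < emeasure M (E i)" if "i < k" for i
  proof (rule ccontr)
    assume "\<not> ?thesis"
    then have "E i \<in> null_sets M" using sets[OF that] by auto
    then show False using AE_not_in nonnull[OF that] by blast
  qed
  have UNIV_pos: "emeasure M UNIV \<noteq> 0"
    using emeasure_ball_pos[of 1 undefined] emeasure_mono[of "ball undefined 1" UNIV M] by (auto simp: sets_M)
  have UN_sets: "(\<Union>i<k. E i) \<in> sets M" using sets by auto
  \<comment> \<open>In finite measure the constant 1 is a Besov function; it can vanish outside the
    atoms only if they cover almost everything.\<close>
  have cover: "AE x in M. x \<in> (\<Union>i<k. E i)" if "emeasure M UNIV < \<infinity>"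
    using zero[OF const_besov[OF that, of 1]] by eventually_elim auto
  have piece_const: "\<exists>c. AE x in M. x \<in> E i \<longrightarrow> f x = c"
    if "i < k" "f \<in> besov (restrict_space M (E i)) p \<theta>" for i f
    using besov_restrict_ae_constant[OF that(2) sets ind p0(1) nonnull const] that(1) by blast
  have const_piece: "f \<in> besov (restrict_space M (E i)) p \<theta>"
    if "i < k" "f \<in> borel_measurable M" "AE x in M. x \<in> E i \<longrightarrow> f x = c" for i f c
    using besov_restrict_if_constant[OF that(2) sets fin that(3)] that(1) by blast
  show ?thesis
  proof (cases "k = 0")
    case True
    have "emeasure M UNIV = \<infinity>"
    proof (rule ccontr)
      assume "\<not> ?thesis"
      \<comment> \<open>Without atoms, an empty union would have full measure.\<close>
      then have "AE x in M. False" using cover True by (simp add: less_top)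
      then show False using UNIV_pos by (simp add: trivial_limit_def[symmetric] ae_filter_eq_bot_iff)
    qed
    moreover have "besov M p \<theta> = {u \<in> borel_measurable M. AE x in M. u x = 0}"
    proof (intro set_eqI iffI)
      fix u :: "'a \<Rightarrow> real" assume u: "u \<in> besov M p \<theta>"
      then show "u \<in> {u \<in> borel_measurable M. AE x in M. u x = 0}"
        using zero[OF u] True besov_measurable by auto
    next
      fix u :: "'a \<Rightarrow> real" assume "u \<in> {u \<in> borel_measurable M. AE x in M. u x = 0}"
      then have u: "u \<in> borel_measurable M" "AE x in M. 0 = u x" by (auto simp: eq_commute[of 0])
      show "u \<in> besov M p \<theta>" by (rule V.cong_AE_V[OF V.zero_V u])
    qed
    moreover have "critical_exponent M p \<le> ennreal \<theta>"
      by (rule critical_exponent_le[OF C p0(2) \<theta>]) (use zero True in \<open>auto simp: ae_constant_def\<close>)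
    ultimately show ?thesis by blast
  next
    case False
    have k: "1 \<le> k" using False by simp
    have two: "emeasure M (UNIV - (\<Union>i<k. E i)) = 0" if "emeasure M UNIV < \<infinity>"
    proof -
      have "UNIV - (\<Union>i<k. E i) \<in> sets M" using sets.compl_sets[OF UN_sets] by simp
      then show ?thesis
        using cover[OF that] AE_iff_measurable[of "UNIV - (\<Union>i<k. E i)" M "\<lambda>x. x \<in> (\<Union>i<k. E i)"]
        by auto
    qed
    have four: "besov M p \<theta> = besov_direct_sum M p \<theta> k E"
    proof (intro set_eqI iffI)
      fix f :: "'a \<Rightarrow> real" assume f: "f \<in> besov M p \<theta>"
      have "f \<in> besov (restrict_space M (E i)) p \<theta>" if "i < k" for i
        using const[OF f that] const_piece[OF that besov_measurable[OF f]] by blast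
      then show "f \<in> besov_direct_sum M p \<theta> k E"
        using f zero[OF f] by (auto simp: besov_direct_sum_def besov_pieces_def besov_iff)
    next
      fix f :: "'a \<Rightarrow> real" assume f: "f \<in> besov_direct_sum M p \<theta> k E"
      then have pieces: "\<And>i. i < k \<Longrightarrow> f \<in> besov (restrict_space M (E i)) p \<theta>"
        and f0: "AE x in M. x \<notin> (\<Union>i<k. E i) \<longrightarrow> f x = 0" and meas: "f \<in> borel_measurable M"
        by (simp_all add: besov_direct_sum_def besov_pieces_def Lp_fun_iff)
      \<comment> \<open>The restrictions determine \<open>f\<close> up to null sets: a constant on
        each atom and 0 elsewhere, hence a combination of the indicators.\<close>
      have "\<forall>i. \<exists>c. i < k \<longrightarrow> (AE x in M. x \<in> E i \<longrightarrow> f x = c)" using piece_const pieces by blast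
      then obtain c where "\<And>i. i < k \<Longrightarrow> AE x in M. x \<in> E i \<longrightarrow> f x = c i" by metis
      then have "AE x in M. f x = (\<Sum>i<k. c i * indicat_real (E i) x)"
        by (rule AE_eq_sum_disjoint_indicators[OF disj _ f0])
      then have eq: "AE x in M. (\<Sum>i<k. c i * indicat_real (E i) x) = f x" by eventually_elim simp
      have "(\<lambda>x. \<Sum>i<k. c i * indicat_real (E i) x) \<in> besov M p \<theta>" by (rule V.sum_V) (rule ind)
      then show "f \<in> besov M p \<theta>" using meas eq by (rule V.cong_AE_V)
    qed
    have four': "besov M p \<theta> = besov_pieces M p \<theta> k E" if "emeasure M UNIV < \<infinity>"
    proof -
      have "AE x in M. x \<notin> (\<Union>i<k. E i) \<longrightarrow> f x = 0" for f :: "'a \<Rightarrow> real"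
        using cover[OF that] by eventually_elim blast
      then show ?thesis unfolding four besov_direct_sum_def by blast
    qed
    have dim1: "has_ae_dim (restrict_space M (E i)) (besov (restrict_space M (E i)) p \<theta>) 1"
      if i: "i < k" for i
    proof -
      have Ei: "E i \<inter> space M \<in> sets M" using sets[OF i] by simp
      \<comment> \<open>The constant 1 spans because functions on an atom are constant, and is
        independent because the atom is not null.\<close>
      have "ae_basis (restrict_space M (E i)) (besov (restrict_space M (E i)) p \<theta>) 1 (\<lambda>_ _. 1)"
        unfolding ae_basis_def
      proof (intro conjI allI impI ballI)
        show "(\<lambda>x. 1) \<in> besov (restrict_space M (E i)) p \<theta>"
          by (rule const_piece[OF i, where c = 1]) auto
      next
        fix c :: "nat \<Rightarrow> real" and j :: nat
        assume c: "AE x in restrict_space M (E i). (\<Sum>j<1. c j * 1) = 0" and "j < 1"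
        show "c j = 0"
        proof (rule ccontr)
          assume "c j \<noteq> 0"
          have "AE x in M. x \<in> E i \<longrightarrow> (\<Sum>j<1. c j * 1) = 0"
            using c by (simp only: AE_restrict_space_iff[OF Ei])
          then have "AE x in M. x \<notin> E i"
            by eventually_elim (use \<open>c j \<noteq> 0\<close> \<open>j < 1\<close> in simp)
          then show False using nonnull[OF i] by blast
        qed
      next
        fix f assume "f \<in> besov (restrict_space M (E i)) p \<theta>"
        then obtain c where "AE x in M. x \<in> E i \<longrightarrow> f x = c" using piece_const[OF i] by blast
        then show "\<exists>c. AE x in restrict_space M (E i). f x = (\<Sum>j<(1 :: nat). c j * 1)"
          by (intro exI[of _ "\<lambda>_. c"]) (simp add: AE_restrict_space_iff[OF Ei])
      qed
      then show ?thesis unfolding has_ae_dim_def by blast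
    qed
    have five: "ks_energy M p \<theta> (indicat_real (E i)) = 0" if "i < k" for i
      by (rule ks_energy_besov[OF ind[OF that] q0 p0(2)])
    have six: "ks_energy M p \<theta> (\<lambda>x. u x * indicat_real (E j) x) =
          Limsup (at_right 0) (\<lambda>r::real.
            \<integral>\<^sup>+x\<in>E j. (\<integral>\<^sup>+y\<in>ball x r \<inter> E j.
              ennreal (\<bar>u y - u x\<bar> powr p) /
                (ennreal (r powr (\<theta> * p)) * emeasure M (ball x r)) \<partial>M) \<partial>M)"
      if u: "u \<in> ks_space M p \<theta> \<inter> Linfty_fun M" and j: "j < k" for u j
    proof -
      obtain B where "u \<in> borel_measurable M" "AE x in M. \<bar>u x\<bar> \<le> B"
        using u unfolding Linfty_fun_def by blast
      then show ?thesis by (rule ks_energy_cut_off[OF _ _ sets[OF j] ind[OF j] q0 p0(2)])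
    qed
    have seven: "ennreal \<theta> \<le> critical_exponent M p"
      if k': "1 < k \<or> emeasure M UNIV = \<infinity> \<and> k = 1"
    proof -
      have "0 < k" using False by simp
      have "\<not> ae_constant M (indicat_real (E 0))"
      proof
        assume "ae_constant M (indicat_real (E 0))"
        then obtain c where c: "AE x in M. indicat_real (E 0) x = c" by (auto simp: ae_constant_def)
        \<comment> \<open>A constant indicator of a non-null set means that \<open>E 0\<close> has
          full measure. That leaves no room for a second atom, and contradicts the finite measure of
          \<open>E 0\<close> when the space has infinite measure.\<close>
        have "c \<noteq> 0"
        proof
          assume "c = 0"
          then have "AE x in M. x \<notin> E 0" using c by (simp add: indicator_eq_0_iff)
          then show False using nonnull[OF \<open>0 < k\<close>] by blast
        qed
        have full: "AE x in M. x \<in> E 0"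
          using c by eventually_elim (use \<open>c \<noteq> 0\<close> in \<open>auto simp: indicator_def split: if_splits\<close>)
        from k' show False
        proof
          assume "1 < k"
          have "AE x in M. x \<notin> E 1"
            using full by eventually_elim
              (use disj \<open>1 < k\<close> in \<open>auto simp: disjoint_family_on_def disjoint_iff\<close>)
          then show False using nonnull[OF \<open>1 < k\<close>] by blast
        next
          assume inf: "emeasure M UNIV = \<infinity> \<and> k = 1"
          have "emeasure M (E 0) = emeasure M UNIV"
            by (rule emeasure_eq_AE) (use full sets[OF \<open>0 < k\<close>] sets_M in auto)
          then show False using fin[OF \<open>0 < k\<close>] inf by simp
        qed
      qed
      then show ?thesis unfolding critical_exponent_def
        using ind[OF \<open>0 < k\<close>] \<theta> by (intro Sup_upper) blast
    qed
    have seven': "critical_exponent M p \<le> ennreal \<theta>" if fin: "emeasure M UNIV < \<infinity>" and k1: "k = 1"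
    \<comment> \<open>The single atom has full measure, so constancy on it is constancy almost
      everywhere.\<close>
    proof (rule critical_exponent_le[OF C p0(2) \<theta>])
      fix u :: "'a \<Rightarrow> real" assume u: "u \<in> besov M p \<theta>"
      obtain c where "AE x in M. x \<in> E 0 \<longrightarrow> u x = c" using const[OF u, of 0] k1 by auto
      then have "AE x in M. u x = c" using cover[OF fin] by eventually_elim (use k1 in auto)
      then show "ae_constant M u" unfolding ae_constant_def by blast
    qed
    show ?thesis
      by (intro disjI2 conjI exI[of _ E] allI ballI impI;
        (rule k sets pos fin two ind basis four four' dim1 five six seven seven';
          (assumption | erule conjunct1 | erule conjunct2)?))
  qed
qed

end
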